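(* Let $(B,L)$ be a Hadamard pair with scaling factor $R$, of size $|B|=|L|=2,3,4$ or $5$, and assume that all extreme cycles for $(B,L)$ are contained in $\mathbb{Z}$. Then $(B,L)$ has a complementary Hadamard pair, i.e., there exists a Hadamard pair $(B',L')$ with scaling factor $R$ such that $(B,L)$ and $(B',L')$ are complementary.
   Context: Hadamard pair: for an integer $R\ge2$ and finite sets $B,L\subset\mathbb{Z}$ with $0\in B$, $0\in L$, $(B,L)$ is a Hadamard pair with scaling factor $R$ if $\#B=\#L=N$ and the matrix $\frac{1}{\sqrt N}\left(e^{2\pi i R^{-1}bl}\right)_{b\in B,l\in L}$ is unitary. Extreme cycles: put $m_B(x)=\frac1N\sum_{b\in B}e^{2\pi i bx}$. A finite set $\{x_0,\dots,x_{r-1}\}\subset\mathbb{R}$ is a cycle for $L$ if there exist $l_0,\dots,l_{r-1}\in L$ with $\frac{x_0+l_0}{R}=x_1,\dots,\frac{x_{r-2}+l_{r-2}}{R}=x_{r-1},\frac{x_{r-1}+l_{r-1}}{R}=x_0$; it is extreme for $(B,L)$ if $|m_B(x_k)|=1$ for all $k$. Direct sum: sets $A,A'\subset\mathbb{R}$ have disjoint differences if $(A-A)\cap(A'-A')=\{0\}$; in this case $A\oplus A'=\{a+a':a\in A,a'\in A'\}$ (the sign $\oplus$ asserts disjoint differences). Complementary Hadamard pairs: two Hadamard pairs $(B,L)$, $(B',L')$ with the same scaling factor $R$ (of possibly different sizes) are complementary if (1) $B\oplus B'$ and $L\oplus L'$ are complete sets of representatives modulo $R$; (2) the extreme cycles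 for $(B,L)$ and the extreme cycles for $(B',L')$ are contained in $\mathbb{Z}$; (3) the greatest common divisor of the elements of $B\oplus B'$ is $1$. *)

theory Defs
  imports Complex_Main "HOL-Number_Theory.Cong"
begin

(* Matrices with rows indexed by a finite set I and columns by a finite set J;
   for card I = card J this is U U* = 1 together with U* U = 1. *)
definition unitary_matrix :: "'i set \<Rightarrow> 'j set \<Rightarrow> ('i \<Rightarrow> 'j \<Rightarrow> complex) \<Rightarrow> bool" where
  "unitary_matrix I J U \<longleftrightarrow>
     (\<forall>i\<in>I. \<forall>i'\<in>I. (\<Sum>j\<in>J. U i j * cnj (U i' j)) = (if i = i' then 1 else 0)) \<and>
     (\<forall>j\<in>J. \<forall>j'\<in>J. (\<Sum>i\<in>I. cnj (U i j) * U i j') = (if j = j' then 1 else 0))"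

definition hadamard_pair :: "int \<Rightarrow> int set \<Rightarrow> int set \<Rightarrow> bool" where
  "hadamard_pair R B L \<longleftrightarrow>
     2 \<le> R \<and> finite B \<and> finite L \<and> 0 \<in> B \<and> 0 \<in> L \<and> card B = card L \<and>
     unitary_matrix B L
       (\<lambda>b l. complex_of_real (1 / sqrt (real (card B))) *
              cis (2 * pi * real_of_int b * real_of_int l / real_of_int R))"

definition mask :: "int set \<Rightarrow> real \<Rightarrow> complex" where
  "mask B x = (1 / of_nat (card B)) * (\<Sum>b\<in>B. cis (2 * pi * real_of_int b * x))"

(* The points x 0, ..., x (r - 1) are not required to be distinct. *)
definition cycle :: "int \<Rightarrow> int set \<Rightarrow> real set \<Rightarrow> bool" where
  "cycle R L C \<longleftrightarrow>
     (\<exists>r x l. 0 < r \<and> C = x ` {..<r} \<and>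
        (\<forall>k<r. l k \<in> L \<and>
           (x k + real_of_int (l k)) / real_of_int R = x (Suc k mod r)))"

definition extreme_cycle :: "int \<Rightarrow> int set \<Rightarrow> int set \<Rightarrow> real set \<Rightarrow> bool" where
  "extreme_cycle R B L C \<longleftrightarrow> cycle R L C \<and> (\<forall>x\<in>C. cmod (mask B x) = 1)"

definition disjoint_differences :: "'a::ab_group_add set \<Rightarrow> 'a set \<Rightarrow> bool" where
  "disjoint_differences A A' \<longleftrightarrow>
     {a - b | a b. a \<in> A \<and> b \<in> A} \<inter> {a - b | a b. a \<in> A' \<and> b \<in> A'} = {0}"

(* Denotes the direct sum of A and A' only in conjunction with disjoint_differences A A'. *)
definition sumset :: "'a::ab_group_add set \<Rightarrow> 'a set \<Rightarrow> 'a set" where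
  "sumset A A' = {a + a' | a a'. a \<in> A \<and> a' \<in> A'}"

definition complete_representatives :: "int \<Rightarrow> int set \<Rightarrow> bool" where
  "complete_representatives R S \<longleftrightarrow> (\<forall>n. \<exists>!s. s \<in> S \<and> [s = n] (mod R))"

definition complementary ::
  "int \<Rightarrow> int set \<Rightarrow> int set \<Rightarrow> int set \<Rightarrow> int set \<Rightarrow> bool" where
  "complementary R B L B' L' \<longleftrightarrow>
     hadamard_pair R B L \<and> hadamard_pair R B' L' \<and>
     disjoint_differences B B' \<and> complete_representatives R (sumset B B') \<and>
     disjoint_differences L L' \<and> complete_representatives R (sumset L L') \<and>
     (\<forall>C. extreme_cycle R B L C \<longrightarrow> C \<subseteq> \<int>) \<and>
     (\<forall>C. extreme_cycle R B' L' C \<longrightarrow> C \<subseteq> \<int>) \<and>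
     Gcd (sumset B B') = 1"

end

theory Submission
  imports Defs "HOL-Computational_Algebra.Polynomial" "HOL-Library.FuncSet"
begin

text \<open>If \<open>B\<close> has \<open>p ^ k\<close> elements with \<open>p\<close> prime, the \<open>p\<close>-adic valuations of differences in \<open>B\<close> take only
  \<open>k\<close> values, all smaller than the valuation \<open>\<rho>\<close> of \<open>R\<close>, and those of \<open>L\<close> are their mirror images
  under \<open>s \<mapsto> \<rho> - 1 - s\<close>. For 2, 3 and 4 elements this follows from the geometry of vanishing sums of unit
  numbers. For 5 elements a vanishing sum of roots of unity is either a rotated set of fifth roots of unity or
  the union of an antipodal pair and a rotated set of cube roots of unity; the second kind is excluded because
  the differences producing it would all have the same 2-adic valuation, which is impossible for the three
  differences of three integers. The complement of \<open>B\<close> then consists of the integers whose base \<open>p\<close> digits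
  vanish at the \<open>k\<close> positions used by \<open>B\<close>, and similarly for \<open>L\<close>. Unless it is \<open>{0}\<close>, the complement
  contains a divisor of \<open>R\<close>, which makes its extreme cycles integral and the gcd equal to 1. If it is \<open>{0}\<close>,
  a gcd larger than 1 would produce a nonintegral extreme cycle of \<open>(B, L)\<close>.\<close>

section \<open>Conjugates of roots of unity\<close>

text \<open>The mirror has one source: if \<open>unity_root R (b * (l - l'))\<close> and
  \<open>unity_root R (b' * (l - l'))\<close> are different but have equal \<open>p\<close>-th
  powers, then the valuations of \<open>b - b'\<close> and \<open>l - l'\<close> add up to
  \<open>\<rho> - 1\<close>. For up to four terms, zero sums of unit numbers are solved by complex
  conjugation alone; five unit numbers with sum zero still move in a continuous family. Size five
  therefore needs arithmetic: a relation between roots of unity survives raising all of them to a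
  power prime to their order, which rests on the irreducibility argument for cyclotomic polynomials.
  Besides triangles in \<open>L\<close> whose three differences are all of the second kind there are
  mixed ones; they fail 5-adically or because \<open>5 - 2 * 2 = 1\<close>. In the complement, the
  part \<open>M\<close> of \<open>R\<close> prime to \<open>p\<close> becomes the radix of a single
  leading digit.\<close>

abbreviation int_eval :: "int poly \<Rightarrow> complex \<Rightarrow> complex" where
  "int_eval F z \<equiv> poly (map_poly of_int F) z"

lemma int_eval_pCons: "int_eval (pCons a F) z = of_int a + z * int_eval F z"
  by (simp add: map_poly_pCons)

lemma int_eval_add: "int_eval (F + G) z = int_eval F z + int_eval G z"
  by (induction F G rule: poly_induct2) (simp_all add: int_eval_pCons algebra_simps)

lemma int_eval_smult: "int_eval (smult c F) z = of_int c * int_eval F z"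
  by (simp add: map_poly_smult)

lemma int_eval_mult: "int_eval (F * G) z = int_eval F z * int_eval G z"
  by (induction F) (simp_all add: int_eval_pCons int_eval_add int_eval_smult algebra_simps)

lemma int_eval_diff: "int_eval (F - G) z = int_eval F z - int_eval G z"
  using int_eval_add[of "F - G" G z] by (simp add: algebra_simps)

lemma int_eval_monom: "int_eval (monom c k) z = of_int c * z ^ k"
  by (simp add: map_poly_monom poly_monom)

lemma int_eval_sum: "int_eval (\<Sum>i\<in>I. F i) z = (\<Sum>i\<in>I. int_eval (F i) z)"
  by (induction I rule: infinite_finite_induct) (simp_all add: int_eval_add)

lemma int_eval_pcompose_monom: "int_eval (F \<circ>\<^sub>p monom 1 k) z = int_eval F (z ^ k)"
  by (induction F)
    (simp_all add: pcompose_pCons int_eval_add int_eval_mult int_eval_pCons int_eval_monom)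

section \<open>Frobenius modulo a prime for integer polynomials\<close>

lemma prime_dvd_binomial_remainder:
  fixes x y :: "'a::comm_ring_1"
  assumes "prime p"
  shows "of_nat p dvd (x + y) ^ p - x ^ p - y ^ p"
proof -
  have p: "p \<ge> 2" using assms by (rule prime_ge_2_nat)
  have split: "{..p} = insert 0 (insert p {1..<p})" using p by auto
  have "(x + y) ^ p = (\<Sum>k\<le>p. of_nat (p choose k) * x ^ k * y ^ (p - k))"
    by (rule binomial_ring)
  also have "\<dots> = x ^ p + y ^ p + (\<Sum>k\<in>{1..<p}. of_nat (p choose k) * x ^ k * y ^ (p - k))"
    unfolding split using p by simp
  finally have "(x + y) ^ p - x ^ p - y ^ p = (\<Sum>k\<in>{1..<p}. of_nat (p choose k) * x ^ k * y ^ (p - k))"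
    by simp
  moreover have "of_nat p dvd (of_nat (p choose k) * x ^ k * y ^ (p - k) :: 'a)" if "k \<in> {1..<p}" for k
  proof -
    have "p dvd p choose k" using that by (intro dvd_choose_prime assms) auto
    then have "(of_nat p :: 'a) dvd of_nat (p choose k)" by (auto elim!: dvdE)
    then show ?thesis by (simp add: mult.assoc)
  qed
  ultimately show ?thesis by (metis (no_types, lifting) dvd_sum)
qed

lemma fermat_int:
  fixes a :: int
  assumes "prime p"
  shows "int p dvd a ^ p - a"
proof (induction a rule: int_induct[where k = 0])
  case base
  then show ?case using assms by (simp add: prime_gt_0_nat zero_power)
next
  case (step1 a)
  then show ?case
    using dvd_add[OF prime_dvd_binomial_remainder[OF assms, of a 1] step1(2)]
    by (simp add: algebra_simps)
next
  case (step2 a)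
  then show ?case
    using dvd_diff[OF step2(2) prime_dvd_binomial_remainder[OF assms, of "a - 1" 1]]
    by (simp add: algebra_simps)
qed

text \<open>With \<open>pCons a F\<close> read as \<open>a + X * F\<close>, the binomial remainder
  is divisible by \<open>p\<close>, Fermat replaces \<open>a ^ p\<close> by \<open>a\<close>, and
  the induction hypothesis handles \<open>F\<close>.\<close>

lemma frobenius_int_poly:
  fixes F :: "int poly"
  assumes "prime p"
  shows "of_nat p dvd F ^ p - F \<circ>\<^sub>p monom 1 p"
proof (induction F)
  case 0
  then show ?case using assms by (simp add: prime_gt_0_nat zero_power)
next
  case (pCons a F)
  let ?X = "monom 1 1 :: int poly"
  have dec: "pCons a F = [:a:] + ?X * F" by (simp add: monom_altdef)
  have 1: "of_nat p dvd (pCons a F) ^ p - [:a:] ^ p - (?X * F) ^ p"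
    unfolding dec by (rule prime_dvd_binomial_remainder[OF assms])
  have "of_nat p dvd ([:a ^ p - a:] :: int poly)"
    using fermat_int[OF assms, of a] by (simp add: of_nat_poly)
  then have 2: "of_nat p dvd ([:a:] ^ p - [:a:] :: int poly)"
    by (simp add: poly_const_pow)
  have X: "?X ^ p = monom 1 p" by (metis monom_altdef mult_1 nat_mult_1 power_mult power_one_right smult_1_left)
  have 3: "of_nat p dvd monom 1 p * (F ^ p - F \<circ>\<^sub>p monom 1 p)" using pCons(2) by simp
  have "pCons a F ^ p - pCons a F \<circ>\<^sub>p monom 1 p =
     (pCons a F ^ p - [:a:] ^ p - (?X * F) ^ p) + ([:a:] ^ p - [:a:]) + monom 1 p * (F ^ p - F \<circ>\<^sub>p monom 1 p)"
    by (simp add: pcompose_pCons power_mult_distrib X[unfolded One_nat_def] algebra_simps)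
  with dvd_add[OF dvd_add[OF 1 2] 3] show ?case by metis
qed

section \<open>Integral minimal polynomials and conjugation of roots of unity\<close>

text \<open>A polynomial of least degree, made primitive, divides over the integers and not merely
  over the rationals. This is Gauss's lemma, carried out by pseudo-division and a comparison of
  contents.\<close>

lemma integer_minimal_polynomial:
  fixes z :: complex
  assumes "F0 \<noteq> 0" "int_eval F0 z = 0"
  obtains f where "content f = 1" "int_eval f z = 0" "\<And>F. int_eval F z = 0 \<Longrightarrow> f dvd F"
proof -
  obtain f0 where f0: "f0 \<noteq> 0" "int_eval f0 z = 0"
      and least: "\<And>g. g \<noteq> 0 \<Longrightarrow> int_eval g z = 0 \<Longrightarrow> degree f0 \<le> degree g"
    using ex_has_least_nat[of "\<lambda>g. g \<noteq> 0 \<and> int_eval g z = 0" F0 degree] assms by blast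
  define f where "f = primitive_part f0"
  have c: "content f = 1" using f0(1) by (simp add: f_def)
  have "f0 = smult (content f0) f" by (simp add: f_def)
  then have "of_int (content f0) * int_eval f z = 0" using f0(2) by (metis int_eval_smult)
  then have fz: "int_eval f z = 0" using f0(1) by simp
  have "f \<noteq> 0" using c by auto
  have deg: "degree f = degree f0" by (simp add: f_def)
  have "f dvd F" if F: "int_eval F z = 0" for F
  proof -
    obtain a q where aq: "a \<noteq> 0" "smult a F = f * q + pseudo_mod F f"
      using pseudo_mod(1)[OF \<open>f \<noteq> 0\<close>] by blast
    have "int_eval (pseudo_mod F f) z = 0"
      using arg_cong[OF aq(2), of "\<lambda>h. int_eval h z"] F fz
      by (simp add: int_eval_add int_eval_mult int_eval_smult)
    then have "pseudo_mod F f = 0"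
      using pseudo_mod(2)[OF \<open>f \<noteq> 0\<close>, of F] least[of "pseudo_mod F f"] deg by linarith
    with aq have eq: "smult a F = f * q" by simp
    have "normalize a * content F = content q"
      using arg_cong[OF eq, of content] c by (simp add: content_mult)
    then have "a dvd content q" by (metis dvd_triv_left normalize_dvd_iff)
    then obtain q' where "q = smult a q'"
      by (metis content_times_primitive_part dvdE smult_smult)
    then have "smult a F = smult a (f * q')" using eq by simp
    then have "F = f * q'" using aq(1) by (simp add: smult_cancel)
    then show ?thesis by simp
  qed
  with c fz show ?thesis by (rule that)
qed

text \<open>The classical argument for the irreducibility of cyclotomic polynomials. With
  \<open>U = f * g\<close> and \<open>f\<close> minimal for \<open>z\<close>, failure of
  \<open>f\<close> at \<open>z ^ p\<close> makes \<open>g\<close> vanish there, so \<open>f\<close>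
  divides \<open>g(X ^ p)\<close>, which is \<open>g ^ p\<close> modulo \<open>p\<close>. This
  contradicts the separability of \<open>X ^ n - 1\<close> modulo \<open>p\<close>; all computations
  stay among integer polynomials.\<close>

lemma root_of_unity_prime_conjugate:
  fixes z :: complex
  assumes "0 < n" "z ^ n = 1" "prime p" "\<not> p dvd n" "int_eval F z = 0"
  shows "int_eval F (z ^ p) = 0"
proof -
  define U :: "int poly" where "U = monom 1 n - 1"
  have U_eval: "int_eval U w = w ^ n - 1" for w
    unfolding U_def by (simp add: int_eval_diff int_eval_monom)
  have degU: "degree U = n" 
    unfolding U_def using assms(1)
    by (metis degree_1 degree_add_eq_left degree_minus degree_monom_eq diff_conv_add_uminus zero_neq_one)
  have U0: "U \<noteq> 0" using degU assms(1) by auto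
  obtain f where f: "content f = 1" "int_eval f z = 0" "\<And>F. int_eval F z = 0 \<Longrightarrow> f dvd F"
    using integer_minimal_polynomial[OF U0, of z] U_eval assms(2) by auto
  obtain g where g: "U = f * g" using f(3)[of U] U_eval assms(2) by (auto elim: dvdE)
  have "lead_coeff U = 1"
    unfolding degU using assms(1) by (simp add: U_def)
  then have lc: "lead_coeff f dvd 1" by (metis g lead_coeff_mult dvd_triv_left)
  have fp: "int_eval f (z ^ p) = 0"
  proof (rule ccontr)
    assume nz: "int_eval f (z ^ p) \<noteq> 0"
    have "int_eval U (z ^ p) = 0"
      using assms(2) by (simp add: U_eval flip: power_mult) (metis mult.commute power_mult power_one)
    then have "int_eval g (z ^ p) = 0" using nz by (simp add: g int_eval_mult)
    then have "f dvd g \<circ>\<^sub>p monom 1 p" by (intro f(3)) (simp add: int_eval_pcompose_monom)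
    then obtain D where D: "g \<circ>\<^sub>p monom 1 p = f * D" by (auto elim: dvdE)
    obtain C where C: "g ^ p - g \<circ>\<^sub>p monom 1 p = of_nat p * C"
      using frobenius_int_poly[OF assms(3), of g] by (auto elim: dvdE)
    have gp: "g ^ p = f * D + of_nat p * C" using C D by (simp add: algebra_simps)
    define X :: "int poly" where "X = monom 1 1"
    have n1: "X * monom 1 (n - 1) = monom 1 n"
      using assms(1) by (simp add: X_def mult_monom)
    \<comment> \<open>Separability in explicit form: \<open>n = X * U' - n * U\<close>, which for
      \<open>U = f * g\<close> becomes a Bezout identity between \<open>f\<close> and
      \<open>g\<close>.\<close>
    have "pderiv U = smult (int n) (monom 1 (n - 1))"
      by (simp add: U_def pderiv_diff pderiv_monom smult_monom)
    then have "X * pderiv U = smult (int n) (U + 1)"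
      using n1 by (simp add: U_def)
    then have "of_nat n = X * pderiv U - of_nat n * U"
      by (simp add: of_nat_poly algebra_simps smult_add_right)
    then have "of_nat n = f * (X * pderiv g - of_nat n * g) + g * (X * pderiv f)"
      by (simp add: g pderiv_mult algebra_simps)
    then obtain A B where AB: "of_nat n = f * A + g * B" by blast
    obtain E where E: "(f * A + g * B) ^ p = f * E + g ^ p * B ^ p"
    proof -
      have "f * A dvd (f * A + g * B) ^ p - (g * B) ^ p"
        using power_diff_sumr2[of "f * A + g * B" p "g * B"] by simp
      then obtain E where "(f * A + g * B) ^ p - (g * B) ^ p = f * A * E" by (auto elim: dvdE)
      then have "(f * A + g * B) ^ p = f * (A * E) + g ^ p * B ^ p"
        by (simp add: power_mult_distrib algebra_simps)
      then show ?thesis by (rule that)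
    qed
    define H where "H = C * B ^ p"
    define E' where "E' = E + D * B ^ p"
    have main: "of_nat n ^ p = f * E' + of_nat p * H"
      unfolding AB E gp by (simp add: E'_def H_def algebra_simps)
    have "f \<noteq> 0" using f(1) by auto
    \<comment> \<open>The leading coefficient of \<open>f\<close> divides that of the monic
      \<open>U\<close>, so it is a unit and pseudo-division by \<open>f\<close> is true division up
      to sign.\<close>
    obtain a q where "smult a H = f * q + pseudo_mod H f" "a dvd 1"
    proof -
      obtain q r where qr: "pseudo_divmod H f = (q, r)" by fastforce
      have "r = pseudo_mod H f" using qr by (simp add: pseudo_mod_def)
      then show ?thesis using pseudo_divmod(1)[OF \<open>f \<noteq> 0\<close> qr] lc that
        by (metis dvd_power_same power_one)
    qed
    moreover from this(2) have "a * a = 1" by (auto simp: zdvd1_eq abs_if split: if_splits)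
    ultimately have H: "H = f * smult a q + smult a (pseudo_mod H f)"
      by (metis mult_smult_right smult_1_left smult_add_right smult_smult)
    define r where "r = smult a (pseudo_mod H f)"
    have rdeg: "r = 0 \<or> degree r < degree f"
      unfolding r_def using pseudo_mod(2)[OF \<open>f \<noteq> 0\<close>, of H] by auto
    have fdeg: "0 < degree f"
    proof (rule ccontr)
      assume "\<not> 0 < degree f"
      then obtain c where "f = [:c:]" by (auto elim: degree_eq_zeroE)
      then show False using f(1,2) by (simp add: map_poly_pCons)
    qed
    \<comment> \<open>A multiple of \<open>f\<close> of smaller degree vanishes, so
      \<open>n ^ p = p * r\<close>; the constant coefficients then contradict that \<open>p\<close>
      does not divide \<open>n\<close>.\<close>
    have "of_nat n ^ p - of_nat p * r = f * (E' + of_nat p * smult a q)"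
      unfolding main by (subst H) (simp add: r_def algebra_simps)
    moreover have "degree (of_nat n ^ p - of_nat p * r) < degree f"
    proof -
      have "degree (of_nat n ^ p :: int poly) = 0" 
        by (metis degree_of_nat of_nat_power)
      moreover have "degree (of_nat p * r) \<le> degree r"
        by (metis degree_mult_le degree_of_nat add_0)
      then have "degree (of_nat p * r) < degree f" using rdeg fdeg by auto
      ultimately show ?thesis using fdeg by (metis degree_diff_less)
    qed
    ultimately have "of_nat n ^ p - of_nat p * r = 0"
      by (metis dvdI dvd_imp_degree_le leD)
    then have "coeff (of_nat n ^ p) 0 = coeff (of_nat p * r) 0" by simp
    then have "int n ^ p = int p * coeff r 0"
      by (simp add: of_nat_poly coeff_0_power)
    then have "int p dvd int n ^ p" by simp
    then have "p dvd n ^ p" by (metis of_nat_dvd_iff of_nat_power)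
    then show False using assms(3,4) prime_dvd_power by blast
  qed
  obtain Q where "F = f * Q" using f(3)[OF assms(5)] by (auto elim: dvdE)
  then show ?thesis by (simp add: int_eval_mult fp)
qed

text \<open>Each prime factor \<open>p\<close> of \<open>t\<close> replaces \<open>z\<close> by
  \<open>z ^ p\<close>, again an \<open>n\<close>-th root of unity; hence the generalisation over
  \<open>z\<close>.\<close>

lemma root_of_unity_conjugate:
  fixes z :: complex
  assumes "0 < n" "z ^ n = 1" "coprime t n" "int_eval F z = 0"
  shows "int_eval F (z ^ t) = 0"
  using assms(2-4)
proof (induction t arbitrary: z rule: prime_divisors_induct)
  case zero
  then show ?case by simp
next
  case (unit t)
  then show ?case by simp
next
  case (factor p t)
  have "\<not> p dvd n"
    using factor by (metis coprime_common_divisor_nat coprime_mult_left_iff dvd_refl not_prime_1)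
  then have "int_eval F (z ^ p) = 0"
    using factor by (intro root_of_unity_prime_conjugate[OF assms(1)]) auto
  moreover have "(z ^ p) ^ n = 1"
    using factor(3) by (metis mult.commute power_mult power_one)
  ultimately have "int_eval F ((z ^ p) ^ t) = 0"
    using factor by (intro factor(2)) auto
  then show ?case by (simp add: power_mult)
qed

section \<open>Characters of the integers modulo \<open>n\<close> and sums over residue
  classes\<close>

definition unity_root :: "int \<Rightarrow> int \<Rightarrow> complex" where
  "unity_root n k = cis (2 * pi * real_of_int k / real_of_int n)"

lemma unity_root_add: "unity_root n (j + k) = unity_root n j * unity_root n k"
  by (simp add: unity_root_def cis_mult distrib_left add_divide_distrib)

lemma unity_root_zero [simp]: "unity_root n 0 = 1"
  by (simp add: unity_root_def)

lemma norm_unity_root [simp]: "norm (unity_root n k) = 1"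
  by (simp add: unity_root_def)

lemma unity_root_nonzero [simp]: "unity_root n k \<noteq> 0"
  by (metis norm_unity_root norm_zero zero_neq_one)

lemma cnj_unity_root: "cnj (unity_root n k) = unity_root n (- k)"
  by (simp add: unity_root_def cis_cnj)

lemma unity_root_diff: "unity_root n (j - k) = unity_root n j / unity_root n k"
  using unity_root_add[of n "j - k" k] by (simp add: field_simps)

lemma unity_root_power: "unity_root n k ^ t = unity_root n (int t * k)"
  by (induction t) (simp_all add: unity_root_add distrib_right)

lemma unity_root_scale: "c \<noteq> 0 \<Longrightarrow> unity_root (c * n) (c * k) = unity_root n k"
  by (simp add: unity_root_def field_simps)

lemma unity_root_eq_1_iff:
  assumes "n \<noteq> 0"
  shows "unity_root n k = 1 \<longleftrightarrow> n dvd k"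
proof
  assume "unity_root n k = 1"
  then have "cos (2 * pi * real_of_int k / real_of_int n) = 1"
    by (simp add: unity_root_def complex_eq_iff)
  then obtain j :: int where "2 * pi * real_of_int k / real_of_int n = of_int j * 2 * pi"
    using cos_one_2pi_int by auto
  then have "real_of_int k = real_of_int (j * n)"
    using assms by (simp add: field_simps)
  then have "k = j * n" by linarith
  then show "n dvd k" by simp
next
  assume "n dvd k"
  then obtain j where "k = n * j" by (auto elim: dvdE)
  then show "unity_root n k = 1"
    using assms cis_multiple_2pi[of "real_of_int j"] by (simp add: unity_root_def mult.assoc)
qed

lemma unity_root_eq_iff: "n \<noteq> 0 \<Longrightarrow> unity_root n j = unity_root n k \<longleftrightarrow> n dvd j - k"
  using unity_root_eq_1_iff[of n "j - k"] by (simp add: unity_root_diff)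

lemma sum_unity_root_residues:
  assumes "0 < n"
  shows "(\<Sum>k<n. unity_root (int n) (int k * m)) = (if int n dvd m then of_nat n else 0)"
proof (cases "int n dvd m")
  case True
  then have "unity_root (int n) (int k * m) = 1" for k
    using assms by (simp add: unity_root_eq_1_iff)
  with True show ?thesis by simp
next
  case False
  have "unity_root (int n) m \<noteq> 1" using False assms by (simp add: unity_root_eq_1_iff)
  moreover have "unity_root (int n) m ^ n = 1"
    using assms by (simp add: unity_root_power unity_root_eq_1_iff)
  ultimately have "(\<Sum>k<n. unity_root (int n) m ^ k) = 0"
    by (simp add: geometric_sum)
  with False show ?thesis by (simp add: unity_root_power)
qed

text \<open>Once the exponents are reduced modulo \<open>n\<close> to natural numbers, the sum is an
  integer polynomial evaluated at a root of unity, to which conjugation applies.\<close>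

lemma unity_root_sum_conjugate:
  assumes n: "0 < n" and t: "coprime (int t) n" and sum: "(\<Sum>i\<in>I. unity_root n (a i)) = 0"
  shows "(\<Sum>i\<in>I. unity_root n (int t * a i)) = 0"
proof -
  define F :: "int poly" where "F = (\<Sum>i\<in>I. monom 1 (nat (a i mod n)))"
  have eval: "int_eval F (unity_root n (int s)) = (\<Sum>i\<in>I. unity_root n (int s * a i))" for s
  proof -
    have "n dvd int s * (a i mod n) - int s * a i" for i
      by (simp flip: right_diff_distrib) (metis dvd_minus_iff dvd_minus_mod dvd_mult minus_diff_eq)
    then have "unity_root n (int s) ^ nat (a i mod n) = unity_root n (int s * a i)" for i
      using n by (simp add: unity_root_power unity_root_eq_iff mult.commute)
    then show ?thesis by (simp add: F_def int_eval_sum int_eval_monom)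
  qed
  have "int_eval F (unity_root n 1 ^ t) = 0"
  proof (rule root_of_unity_conjugate)
    show "unity_root n 1 ^ nat n = 1" using n by (simp add: unity_root_power unity_root_eq_1_iff)
    show "coprime t (nat n)" using t n by (metis coprime_int_iff int_nat_eq less_le)
    show "int_eval F (unity_root n 1) = 0" using eval[of 1] sum by simp
  qed (use n in simp)
  then show ?thesis using eval[of t] by (simp add: unity_root_power)
qed

text \<open>Raising all roots to the power \<open>1 + k * n / p\<close> multiplies the terms of one residue class modulo \<open>p\<close>
  by a common \<open>p\<close>-th root of unity, so Fourier inversion over \<open>k\<close> isolates the class sums. At most one
  \<open>k\<close> modulo \<open>p\<close>, called \<open>k\<^sub>0\<close>, gives an exponent that is not coprime to \<open>n\<close>.\<close>

lemma residue_class_sums: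
  assumes n: "0 < n" and p: "prime p" "int p dvd n" and fin: "finite I"
    and sum: "(\<Sum>i\<in>I. unity_root n (a i)) = 0"
  obtains C k\<^sub>0 where "\<not> int p dvd k\<^sub>0" "(int p)\<^sup>2 dvd n \<Longrightarrow> C = 0"
    "\<And>r. (\<Sum>i | i \<in> I \<and> int p dvd a i - r. unity_root n (a i)) = unity_root (int p) (- (r * k\<^sub>0)) * C"
proof -
  obtain q where q: "n = int p * q" using p(2) by (auto elim: dvdE)
  have p0: "0 < p" using p(1) by (rule prime_gt_0_nat)
  have q0: "0 < q" using n q p0 by (simp add: zero_less_mult_iff)
  define T where "T k = (\<Sum>i\<in>I. unity_root n (a i) * unity_root (int p) (int k * a i))" for k
  define S where "S r = (\<Sum>i | i \<in> I \<and> int p dvd a i - r. unity_root n (a i))" for r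
  \<comment> \<open>\<open>1 + k * q\<close> is prime to \<open>q\<close> in any case, so only
    divisibility by \<open>p\<close> can prevent it from being an admissible exponent.\<close>
  have T0: "T k = 0" if "\<not> int p dvd 1 + int k * q" for k
  proof -
    have "coprime (1 + int k * q) (int p)"
      using that p(1) by (metis coprime_commute prime_imp_coprime prime_int_nat_transfer prime_nat_int_transfer)
    moreover have "coprime (1 + int k * q) q"
      by (metis add.commute coprime_1_left coprime_mult_left_iff gcd_add_mult gcd.commute coprime_iff_gcd_eq_1)
    ultimately have "coprime (int (nat (1 + int k * q))) n" using q q0 by simp
    from unity_root_sum_conjugate[OF n this sum]
    have "(\<Sum>i\<in>I. unity_root n ((1 + int k * q) * a i)) = 0" using q0 by simp
    moreover have "unity_root n ((1 + int k * q) * a i) = unity_root n (a i) * unity_root (int p) (int k * a i)" for i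
    proof -
      have "(1 + int k * q) * a i = a i + q * (int k * a i)" by (simp add: algebra_simps)
      moreover have "unity_root n (q * (int k * a i)) = unity_root (int p) (int k * a i)"
        using q0 unity_root_scale[of q "int p" "int k * a i"] by (simp add: q mult.commute)
      ultimately show ?thesis by (simp only: unity_root_add)
    qed
    ultimately show ?thesis by (simp add: T_def)
  qed
  have inv: "of_nat p * S r = (\<Sum>k<p. unity_root (int p) (- (int k * r)) * T k)" for r
  proof -
    have "(\<Sum>k<p. unity_root (int p) (- (int k * r)) * T k) =
        (\<Sum>k<p. \<Sum>i\<in>I. unity_root n (a i) * unity_root (int p) (int k * (a i - r)))"
      by (simp add: T_def sum_distrib_left right_diff_distrib unity_root_diff unity_root_add field_simps
          flip: cnj_unity_root) (simp add: cnj_unity_root unity_root_diff[of _ 0, simplified] field_simps)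
    also have "\<dots> = (\<Sum>i\<in>I. unity_root n (a i) * (\<Sum>k<p. unity_root (int p) (int k * (a i - r))))"
      by (subst sum.swap) (simp add: sum_distrib_left)
    also have "\<dots> = (\<Sum>i\<in>I. if int p dvd a i - r then of_nat p * unity_root n (a i) else 0)"
      by (intro sum.cong) (simp_all add: sum_unity_root_residues p0)
    also have "\<dots> = of_nat p * S r"
      using fin by (simp add: S_def sum_distrib_left sum.inter_filter if_distrib cong: if_cong)
    finally show ?thesis by simp
  qed
  show ?thesis
  proof (cases "int p dvd q")
    case True
    then have "\<not> int p dvd 1 + int k * q" for k
      using p(1) by (metis dvd_add_left_iff dvd_mult int_dvd_int_iff not_prime_unit of_nat_1)
    then have "S r = 0" for r using inv[of r] T0 p0 by simp
    \<comment> \<open>All class sums vanish, so \<open>C = 0\<close> fits every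
      \<open>k\<^sub>0\<close> prime to \<open>p\<close>, for instance 1.\<close>
    moreover have "\<not> int p dvd 1" using prime_gt_1_nat[OF p(1)] by simp
    ultimately show ?thesis by (intro that[of 1 0]) (simp_all add: S_def)
  next
    case False
    then have "coprime q (int p)"
      using p(1) by (metis coprime_commute prime_imp_coprime prime_nat_int_transfer)
    then obtain x where x: "[q * x = 1] (mod int p)" using cong_solve_coprime_int by blast
    \<comment> \<open>As \<open>x\<close> inverts \<open>q\<close> modulo \<open>p\<close>, this is
      the residue with \<open>1 + k\<^sub>0 * q\<close> divisible by \<open>p\<close>, the one
      exponent about which conjugation says nothing.\<close>
    define k\<^sub>0 where "k\<^sub>0 = nat ((- x) mod int p)"
    have k0: "int k\<^sub>0 = (- x) mod int p" "k\<^sub>0 < p"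
      using p0 by (simp_all add: k\<^sub>0_def nat_less_iff)
    have "[1 + int k\<^sub>0 * q = 1 + (- x) * q] (mod int p)"
      unfolding k0 by (intro cong_add cong_mult) (simp_all add: cong_def)
    also have "[1 + (- x) * q = 0] (mod int p)"
      using x by (simp add: cong_iff_dvd_diff mult.commute dvd_diff_commute)
    finally have k0_dvd: "int p dvd 1 + int k\<^sub>0 * q" by (simp add: cong_0_iff)
    have other: "T k = 0" if "k < p" "k \<noteq> k\<^sub>0" for k
    proof (rule T0, rule notI)
      assume "int p dvd 1 + int k * q"
      from dvd_diff[OF this k0_dvd] have "int p dvd (int k - int k\<^sub>0) * q"
        by (simp add: left_diff_distrib)
      with False have "int p dvd int k - int k\<^sub>0"
        using p(1) by (metis prime_dvd_mult_iff prime_nat_int_transfer)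
      then have "\<bar>int k - int k\<^sub>0\<bar> \<ge> int p" using that(2) by (intro zdvd_imp_le) (auto dest!: dvd_imp_le_int)
      with that k0(2) show False by linarith
    qed
    have "of_nat p * S r = unity_root (int p) (- (int k\<^sub>0 * r)) * T k\<^sub>0" for r
      unfolding inv using k0(2) other
      by (subst sum.remove[of _ k\<^sub>0]) (auto intro!: sum.neutral)
    then have "S r = unity_root (int p) (- (r * int k\<^sub>0)) * (T k\<^sub>0 / of_nat p)" for r
      using p0 by (simp add: field_simps)
    moreover have "\<not> int p dvd int k\<^sub>0"
      using k0_dvd p(1) by (metis dvd_add_left_iff dvd_mult2 not_prime_unit of_nat_dvd_iff of_nat_1 dvd_mult)
    moreover have "\<not> (int p)\<^sup>2 dvd n"
      using False p0 by (simp add: q power2_eq_square)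
    ultimately show ?thesis using that[of "int k\<^sub>0" "T k\<^sub>0 / of_nat p"] unfolding S_def by blast
  qed
qed

section \<open>Vanishing sums of at most five roots of unity\<close>

lemma cubes_equal:
  fixes x y :: complex
  assumes "x ^ 3 = y ^ 3" "x \<noteq> y"
  shows "x\<^sup>2 + x * y + y\<^sup>2 = 0"
proof -
  have "(x - y) * (x\<^sup>2 + x * y + y\<^sup>2) = x ^ 3 - y ^ 3"
    by (simp add: algebra_simps power2_eq_square power3_eq_cube)
  then show ?thesis using assms by simp
qed

lemma three_cubes_equal:
  fixes x y z :: complex
  assumes "x ^ 3 = y ^ 3" "x ^ 3 = z ^ 3" "x \<noteq> y" "x \<noteq> z" "y \<noteq> z"
  shows "x + y + z = 0"
proof -
  have "(y - z) * (x + y + z) = (x\<^sup>2 + x * y + y\<^sup>2) - (x\<^sup>2 + x * z + z\<^sup>2)"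
    by (simp add: algebra_simps power2_eq_square)
  also have "\<dots> = 0"
    using cubes_equal[OF assms(1,3)] cubes_equal[OF assms(2,4)] by (simp only: diff_self)
  finally have "(y - z) * (x + y + z) = 0" .
  then show ?thesis using assms(5) by simp
qed

lemma unit_complex_inverse: "cmod z = 1 \<Longrightarrow> cnj z = 1 / z"
  by (metis complex_norm_square divide_eq_eq mult.commute mult_zero_left norm_zero of_real_1 one_power2 zero_neq_one)

text \<open>Substituting \<open>z = - (x + y)\<close> into \<open>z * cnj z = 1\<close>, with
  inverses for conjugates, gives \<open>x\<^sup>2 + x * y + y\<^sup>2 = 0\<close>: the quotient
  \<open>x / y\<close> is a primitive cube root of unity.\<close>

lemma three_unit_sum_zero:
  assumes "cmod x = 1" "cmod y = 1" "cmod z = 1" "x + y + z = 0"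
  shows "x ^ 3 = y ^ 3" "x \<noteq> y"
proof -
  have nz: "x \<noteq> 0" "y \<noteq> 0" using assms by auto
  have z: "z = - (x + y)" using assms(4) by (simp only: add_eq_0_iff)
  have "z * cnj z = 1" using unit_complex_inverse[OF assms(3)] assms(3) by auto
  then have "(- x - y) * (- (1 / x) - 1 / y) = 1"
    using assms(1,2) by (simp add: z unit_complex_inverse)
  then have *: "x\<^sup>2 + x * y + y\<^sup>2 = 0"
    using nz by (simp add: field_simps power2_eq_square)
  have "x ^ 3 - y ^ 3 = (x - y) * (x\<^sup>2 + x * y + y\<^sup>2)"
    by (simp add: algebra_simps power2_eq_square power3_eq_cube)
  with * show "x ^ 3 = y ^ 3" by simp
  show "x \<noteq> y" using * nz by (auto simp: power2_eq_square)
qed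

text \<open>Conjugation inverts unit numbers, so besides the first the third elementary symmetric
  polynomial vanishes; hence so does \<open>(x + y) * (x + z) * (x + w)\<close>.\<close>

lemma four_unit_sum_zero:
  assumes "cmod x = 1" "cmod y = 1" "cmod z = 1" "cmod w = 1" "x + y + z + w = 0"
  shows "x = - y \<or> x = - z \<or> x = - w"
proof -
  have nz: "x \<noteq> 0" "y \<noteq> 0" "z \<noteq> 0" "w \<noteq> 0" using assms by auto
  have "cnj x + cnj y + cnj z + cnj w = 0" using assms(5) by (metis complex_cnj_add complex_cnj_zero)
  then have "1 / x + 1 / y + 1 / z + 1 / w = 0" using assms by (simp add: unit_complex_inverse)
  then have e3: "y * z * w + x * z * w + x * y * w + x * y * z = 0"
    using nz by (simp add: field_simps)
  have "(x + y) * (x + z) * (x + w) =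
      x\<^sup>2 * (x + y + z + w) + (y * z * w + x * z * w + x * y * w + x * y * z)"
    by (simp add: algebra_simps power2_eq_square)
  then have "(x + y) * (x + z) * (x + w) = 0" using e3 assms(5) by simp
  then show ?thesis by (auto simp: eq_neg_iff_add_eq_0)
qed

section \<open>Splittings of five unit numbers into two and three\<close>

text \<open>The conditions are pairwise and survive a common rotation. For five elements, those
  outside \<open>P\<close> are three different numbers with one common cube, that is, a rotated set
  of cube roots of unity when they have norm 1.\<close>

definition two_three_split :: "'i set \<Rightarrow> ('i \<Rightarrow> complex) \<Rightarrow> bool" where
  "two_three_split I z \<longleftrightarrow> (\<exists>P\<subseteq>I. card P = 2 \<and>
     (\<forall>i\<in>P. \<forall>j\<in>P. i \<noteq> j \<longrightarrow> z i = - z j) \<and>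
     (\<forall>i\<in>I - P. \<forall>j\<in>I - P. i \<noteq> j \<longrightarrow> z i ^ 3 = z j ^ 3 \<and> z i \<noteq> z j))"

lemma two_three_splitI:
  assumes "I = {i, j, k, l, m}" "distinct [i, j, k, l, m]" "z i = - z j"
    "z k ^ 3 = z l ^ 3" "z k ^ 3 = z m ^ 3" "z k \<noteq> z l" "z k \<noteq> z m" "z l \<noteq> z m"
  shows "two_three_split I z"
proof -
  have "I - {i, j} = {k, l, m}" using assms(1,2) by auto
  with assms show ?thesis
    unfolding two_three_split_def by (intro exI[of _ "{i, j}"]) auto
qed

lemma two_three_split_sums:
  assumes fin: "finite I" "card I = 5" and unit: "\<And>i. i \<in> I \<Longrightarrow> cmod (z i) = 1"
    and P: "P \<subseteq> I" "card P = 2" and sums: "sum z P = 0" "sum z (I - P) = 0"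
  shows "two_three_split I z"
proof -
  obtain i j where ij: "P = {i, j}" "i \<noteq> j" using P(2) by (auto simp: card_2_iff)
  have "card (I - P) = 3" using fin P by (simp add: card_Diff_subset finite_subset)
  then obtain k l m where klm: "I - P = {k, l, m}" "k \<noteq> l" "l \<noteq> m" "k \<noteq> m"
    by (auto simp: card_3_iff)
  have mem: "k \<in> I" "l \<in> I" "m \<in> I" "k \<notin> P" "l \<notin> P" "m \<notin> P" using klm by auto
  have 3: "z k + z l + z m = 0" using sums(2) klm by (simp add: add.assoc)
  have h2: "z k + z m + z l = 0" using 3 by (simp add: algebra_simps)
  have h3: "z l + z m + z k = 0" using 3 by (simp add: algebra_simps)
  show ?thesis
  proof (rule two_three_splitI)
    show "I = {i, j, k, l, m}" using klm(1) ij(1) P(1) by auto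
    show "distinct [i, j, k, l, m]" using klm ij mem by auto
    show "z i = - z j" using sums(1) ij by (simp add: eq_neg_iff_add_eq_0)
    show "z k ^ 3 = z l ^ 3" "z k \<noteq> z l" using three_unit_sum_zero[OF _ _ _ 3] mem unit by auto
    show "z l \<noteq> z m" using three_unit_sum_zero(2)[OF _ _ _ h3] mem unit by auto
    show "z k ^ 3 = z m ^ 3" "z k \<noteq> z m" using three_unit_sum_zero[OF _ _ _ h2] mem unit by auto
  qed
qed

text \<open>No single unit number is zero, so neither the part nor its complement has exactly one
  element; their sizes are 2 and 3, and both have sum zero.\<close>

lemma two_three_split_partial_sum:
  assumes fin: "finite I" "card I = 5" and unit: "\<And>i. i \<in> I \<Longrightarrow> cmod (z i) = 1"
    and sums: "sum z I = 0" "sum z K = 0" and K: "K \<subseteq> I" "K \<noteq> {}" "K \<noteq> I"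
  shows "two_three_split I z"
proof -
  have finK: "finite K" using K(1) fin(1) by (rule finite_subset)
  have diff: "sum z (I - K) = 0" using sum_diff[OF fin(1) K(1), of z] sums by simp
  have cdiff: "card (I - K) = 5 - card K" using fin K(1) finK by (simp add: card_Diff_subset)
  have ne1: "card X \<noteq> 1" if "X \<subseteq> I" "sum z X = 0" for X
  proof
    assume "card X = 1"
    then obtain x where "X = {x}" by (auto simp: card_1_singleton_iff)
    then show False using that unit[of x] by simp
  qed
  have "card K \<noteq> 0" using finK K(2) by simp
  moreover have "card K < 5" using K fin psubset_card_mono[of I K] by auto
  moreover have "card K \<noteq> 1" using ne1 K(1) sums(2) by blast
  moreover have "card K \<noteq> 4" using ne1[of "I - K"] diff cdiff by auto
  ultimately consider "card K = 2" | "card (I - K) = 2" using cdiff by linarith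
  then show ?thesis
  proof cases
    case 1
    then show ?thesis using two_three_split_sums[of I z K] fin unit K(1) sums(2) diff by blast
  next
    case 2
    then show ?thesis
      using two_three_split_sums[of I z "I - K"] fin unit sums(2) diff K(1) by (simp add: double_diff)
  qed
qed

text \<open>The singletons give \<open>w i = w j = C\<close>, so \<open>C\<close> is a unit number.
  The three terms in \<open>K3\<close> together with \<open>- C\<close> have sum zero, so two of
  them cancel and the third equals \<open>C\<close>. This third one and the singletons contribute
  \<open>s3 * C\<close>, \<open>s1 * C\<close> and \<open>s2 * C\<close>, a rotated set of cube
  roots.\<close>

lemma split_three_classes_113:
  assumes K: "K1 \<union> K2 \<union> K3 = I" "K1 \<inter> K2 = {}" "K1 \<inter> K3 = {}" "K2 \<inter> K3 = {}"
    and card: "card K1 = 1" "card K2 = 1" "card K3 = 3"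
    and z: "\<And>i. i \<in> K1 \<Longrightarrow> z i = s1 * w i" "\<And>i. i \<in> K2 \<Longrightarrow> z i = s2 * w i" "\<And>i. i \<in> K3 \<Longrightarrow> z i = s3 * w i"
    and w: "\<And>i. cmod (w i) = 1" "sum w K1 = C" "sum w K2 = C" "sum w K3 = C"
    and s: "s1 ^ 3 = 1" "s2 ^ 3 = 1" "s3 ^ 3 = 1" "s1 \<noteq> s2" "s1 \<noteq> s3" "s2 \<noteq> s3"
  shows "two_three_split I z"
proof -
  obtain i j where ij: "K1 = {i}" "K2 = {j}" using card(1,2) by (auto simp: card_1_singleton_iff)
  obtain k l m where klm: "K3 = {k, l, m}" "k \<noteq> l" "l \<noteq> m" "k \<noteq> m"
    using card(3) by (auto simp: card_3_iff)
  have C: "w i = C" "w j = C" "cmod C = 1" using w(2,3) w(1)[of i] ij by auto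
  have *: "two_three_split I z" if "K3 = {a, b, c}" "a \<noteq> b" "b \<noteq> c" "a \<noteq> c" "w a = C" "w b = - w c" for a b c
  proof (rule two_three_splitI)
    show "I = {b, c, i, j, a}" using K(1) ij that(1) by auto
    show "distinct [b, c, i, j, a]" using K ij that by auto
    show "z b = - z c" using z(3) that by simp
    have [simp]: "z i = s1 * C" "z j = s2 * C" "z a = s3 * C" using z ij that C by auto
    have "C \<noteq> 0" using C(3) by auto
    then show "z i ^ 3 = z j ^ 3" "z i ^ 3 = z a ^ 3" "z i \<noteq> z j" "z i \<noteq> z a" "z j \<noteq> z a"
      using s by (simp_all add: power_mult_distrib)
  qed
  have sum: "w k + w l + w m + (- C) = 0" using w(4) klm by (simp add: add.assoc)
  from four_unit_sum_zero[OF w(1) w(1) w(1) _ this] C(3)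
  consider "w k = - w l" | "w k = - w m" | "w k = C" by auto
  then show ?thesis
  proof cases
    case 1
    then show ?thesis using sum klm by (intro *[of m k l]) auto
  next
    case 2
    then show ?thesis using sum klm by (intro *[of l k m]) auto
  next
    case 3
    then show ?thesis using sum klm by (intro *[of k l m]) (auto simp: eq_neg_iff_add_eq_0)
  qed
qed

text \<open>The singleton makes \<open>C\<close> a unit number. In a two-element class the terms and
  \<open>- C\<close> form a rotated set of cube roots, so \<open>z\<close> takes there the values
  \<open>- t * C\<close> and \<open>- u * C\<close>, where \<open>t\<close> and \<open>u\<close> are
  the two cube roots of unity other than the factor of the class. Thus \<open>- s1 * C\<close>
  occurs twice: one copy cancels \<open>z i\<close>, the other completes the triple with
  \<open>- s2 * C\<close> and \<open>- s3 * C\<close>.\<close>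

lemma split_three_classes_122:
  assumes K: "K1 \<union> K2 \<union> K3 = I" "K1 \<inter> K2 = {}" "K1 \<inter> K3 = {}" "K2 \<inter> K3 = {}"
    and card: "card K1 = 1" "card K2 = 2" "card K3 = 2"
    and z: "\<And>i. i \<in> K1 \<Longrightarrow> z i = s1 * w i" "\<And>i. i \<in> K2 \<Longrightarrow> z i = s2 * w i" "\<And>i. i \<in> K3 \<Longrightarrow> z i = s3 * w i"
    and w: "\<And>i. cmod (w i) = 1" "sum w K1 = C" "sum w K2 = C" "sum w K3 = C"
    and s: "s1 ^ 3 = 1" "s2 ^ 3 = 1" "s3 ^ 3 = 1" "s1 \<noteq> s2" "s1 \<noteq> s3" "s2 \<noteq> s3"
  shows "two_three_split I z"
proof -
  obtain i where i: "K1 = {i}" using card(1) by (auto simp: card_1_singleton_iff)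
  have C: "w i = C" "cmod C = 1" using w(2) w(1)[of i] i by auto
  then have C0: "C \<noteq> 0" by auto
  have pair: "\<exists>a b. X = {a, b} \<and> a \<noteq> b \<and> z a = - (t * C) \<and> z b = - (u * C)"
    if X: "card X = 2" "sum w X = C" "\<And>i. i \<in> X \<Longrightarrow> z i = r * w i"
      and r: "r ^ 3 = 1" "t ^ 3 = 1" "u ^ 3 = 1" "r \<noteq> t" "r \<noteq> u" "t \<noteq> u" for X r t u
  proof -
    obtain a b where ab: "X = {a, b}" "a \<noteq> b" using X(1) by (auto simp: card_2_iff)
    have r0: "r \<noteq> 0" using r(1) by auto
    have sum: "w a + w b + - C = 0" using X(2) ab by simp
    have sum2: "w a + - C + w b = 0" and sum3: "w b + - C + w a = 0"
      using sum by (simp_all add: algebra_simps)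
    have root: "x = t \<or> x = u" if "x ^ 3 = 1" "x \<noteq> r" for x
    proof (rule ccontr)
      assume no: "\<not> (x = t \<or> x = u)"
      have "r + t + u = 0" "r + t + x = 0"
        using three_cubes_equal[of r t u] three_cubes_equal[of r t x] that r no by auto
      then show False using no by (simp add: add_eq_0_iff)
    qed
    have rt: "- (z x / C) = t \<or> - (z x / C) = u" if "x \<in> X" "w x ^ 3 = (- C) ^ 3" "w x \<noteq> - C" for x
    proof (rule root)
      show "(- (z x / C)) ^ 3 = 1"
        using that X(3) C0 r(1) by (simp add: power_mult_distrib power_divide power_minus_odd)
      show "- (z x / C) \<noteq> r"
      proof
        assume "- (z x / C) = r"
        then have "r * w x = r * - C" using X(3)[OF that(1)] C0
          by (metis minus_divide_left minus_equation_iff mult_minus_right nonzero_divide_eq_eq)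
        then show False using that(3) mult_left_cancel[OF r0, of "w x" "- C"] by simp
      qed
    qed
    have 1: "w a ^ 3 = w b ^ 3" "w a \<noteq> w b"
      using three_unit_sum_zero[OF w(1) w(1) _ sum] C(2) by auto
    have 2: "w a ^ 3 = (- C) ^ 3" "w a \<noteq> - C"
      using three_unit_sum_zero[OF w(1) _ w(1) sum2] C(2) by auto
    have 3: "w b ^ 3 = (- C) ^ 3" "w b \<noteq> - C"
      using three_unit_sum_zero[OF w(1) _ w(1) sum3] C(2) by auto
    have ne: "z a \<noteq> z b" using X(3) ab 1(2) r0 by simp
    have "- (z a / C) = t \<or> - (z a / C) = u" "- (z b / C) = t \<or> - (z b / C) = u"
      using rt 2 3 ab by auto
    moreover have "z x = - (y * C)" if "- (z x / C) = y" for x y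
      using C0 that by (simp flip: that)
    ultimately have "z a = - (t * C) \<and> z b = - (u * C) \<or> z b = - (t * C) \<and> z a = - (u * C)"
      using ne by auto
    then show ?thesis
    proof (elim disjE)
      assume "z b = - (t * C) \<and> z a = - (u * C)"
      then show ?thesis using ab by (intro exI[of _ b] exI[of _ a]) auto
    qed (use ab in blast)
  qed
  obtain j k where jk: "K2 = {j, k}" "j \<noteq> k" "z j = - (s1 * C)" "z k = - (s3 * C)"
    using pair[OF card(2) w(3) z(2), of s1 s3] s by auto
  obtain l m where lm: "K3 = {l, m}" "l \<noteq> m" "z l = - (s1 * C)" "z m = - (s2 * C)"
    using pair[OF card(3) w(4) z(3), of s1 s2] s by auto
  show ?thesis
  proof (rule two_three_splitI)
    show "I = {i, j, k, l, m}" using K(1) i jk lm by auto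
    show "distinct [i, j, k, l, m]" using K i jk lm by auto
    show "z i = - z j" using z(1) i C jk by simp
    show "z k ^ 3 = z l ^ 3" "z k ^ 3 = z m ^ 3" "z k \<noteq> z l" "z k \<noteq> z m" "z l \<noteq> z m"
      using jk lm s C0 by (simp_all add: power_mult_distrib power_minus_odd)
  qed
qed

text \<open>For \<open>p = 2\<close> the alternative \<open>4 dvd n\<close> makes the constant
  \<open>C\<close> of \<open>residue_class_sums\<close> vanish. An order without such a prime
  divides 2, and its roots are signs.\<close>

lemma exists_useful_prime:
  fixes n :: int
  assumes "0 < n" "\<not> n dvd 2"
  obtains p :: nat where "prime p" "int p dvd n" "p \<noteq> 2 \<or> 4 dvd n"
proof (cases "\<exists>p. prime p \<and> int p dvd n \<and> p \<noteq> 2")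
  case True
  then show ?thesis using that by blast
next
  case False
  have *: "even m" if "m dvd n" "0 < m" "m \<noteq> 1" for m
  proof -
    have "nat m \<noteq> 1" using that by simp
    then obtain p where p: "prime p" "p dvd nat m" using prime_factor_nat by blast
    then have "int p dvd m" using that(2) by (metis int_dvd_int_iff int_nat_eq less_le)
    then show ?thesis using False p(1) that(1) by (metis dvd_trans of_nat_numeral)
  qed
  have "n \<noteq> 1" using assms(2) by auto
  then obtain m where m: "n = 2 * m" using *[of n] assms(1) by (auto elim: evenE)
  have "m \<noteq> 1" using m assms(2) by auto
  then have "even m" using *[of m] m assms(1) by auto
  then have "4 dvd n" using m by (auto elim!: evenE)
  then show ?thesis using that[of 2] by auto
qed

lemma sum_odd_signs_nonzero:
  fixes z :: "'i \<Rightarrow> complex"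
  assumes "finite I" "odd (card I)" "\<And>i. i \<in> I \<Longrightarrow> z i = 1 \<or> z i = - 1"
  shows "sum z I \<noteq> 0"
proof -
  define s :: "'i \<Rightarrow> int" where "s i = (if z i = 1 then 1 else - 1)" for i
  have "z i = of_int (s i)" if "i \<in> I" for i using assms(3)[OF that] by (auto simp: s_def)
  then have "sum z I = of_int (sum s I)" by simp
  moreover have "odd (sum s I)"
  proof -
    have "{i \<in> I. odd (s i)} = I" by (auto simp: s_def)
    then show ?thesis using assms(1,2) by (simp add: even_sum_iff)
  qed
  ultimately show ?thesis by (metis even_zero of_int_eq_0_iff)
qed

text \<open>Multiplying each root by \<open>unity_root 3 (a i * k\<^sub>0)\<close> makes all three
  class sums equal to \<open>C\<close>. As \<open>C\<close> is not zero, no class is empty, and five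
  elements split as 1 + 1 + 3 or 1 + 2 + 2.\<close>

lemma five_roots_classes_mod_3:
  fixes a :: "'i \<Rightarrow> int"
  assumes fin: "finite I" "card I = 5" and k0: "\<not> 3 dvd k\<^sub>0" and C: "C \<noteq> 0"
    and classes: "\<And>r. (\<Sum>i | i \<in> I \<and> 3 dvd a i - r. unity_root n (a i)) = unity_root 3 (- (r * k\<^sub>0)) * C"
  shows "two_three_split I (\<lambda>i. unity_root n (a i))"
proof -
  define K where "K r = {i \<in> I. 3 dvd a i - r}" for r
  define w where "w i = unity_root n (a i) * unity_root 3 (a i * k\<^sub>0)" for i
  define s where "s r = unity_root 3 (- (r * k\<^sub>0))" for r
  have finK: "finite (K r)" for r using fin by (simp add: K_def)
  have cancel: "s r * unity_root 3 (r * k\<^sub>0) = 1" for r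
    by (simp add: s_def flip: unity_root_add)
  have same: "unity_root 3 (a i * k\<^sub>0) = unity_root 3 (r * k\<^sub>0)" if "i \<in> K r" for i r
    using that by (simp add: K_def unity_root_eq_iff flip: left_diff_distrib)
  have z: "unity_root n (a i) = s r * w i" if "i \<in> K r" for i r
    using cancel[of r] same[OF that] by (simp add: w_def mult.left_commute)
  have sumw: "sum w (K r) = C" for r
  proof -
    have "s r * sum w (K r) = (\<Sum>i\<in>K r. unity_root n (a i))"
      unfolding sum_distrib_left by (intro sum.cong refl) (simp add: z)
    also have "\<dots> = s r * C" using classes[of r] by (simp add: K_def s_def)
    finally show ?thesis using cancel[of r] by auto
  qed
  have s3: "s r ^ 3 = 1" for r
    by (simp add: s_def unity_root_power unity_root_eq_1_iff)
  have s_ne: "s r \<noteq> s r'" if "\<not> 3 dvd r - r'" for r r'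
  proof
    assume "s r = s r'"
    then have "3 dvd (r' - r) * k\<^sub>0" by (simp add: s_def unity_root_eq_iff left_diff_distrib)
    moreover have "prime (3 :: int)" by simp
    ultimately have "3 dvd r' - r" using k0 by (metis prime_dvd_mult_iff)
    then show False using that by (simp add: dvd_diff_commute)
  qed
  have w1: "cmod (w i) = 1" for i by (simp add: w_def norm_mult)
  have ne: "card (K r) \<noteq> 0" for r using sumw[of r] C finK[of r] by auto
  have I: "K r1 \<union> K r2 \<union> K r3 = I" and disj: "K r1 \<inter> K r2 = {}" "K r1 \<inter> K r3 = {}" "K r2 \<inter> K r3 = {}"
    if "distinct [r1, r2, r3]" "{r1, r2, r3} = {0, 1, 2}" for r1 r2 r3
  proof -
    have "i \<in> I \<Longrightarrow> i \<in> K 0 \<union> K 1 \<union> K 2" for i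
      by (simp add: K_def) presburger
    then have "K 0 \<union> K 1 \<union> K 2 = I" by (auto simp: K_def)
    moreover have "K r1 \<union> K r2 \<union> K r3 = (\<Union>r\<in>{r1, r2, r3}. K r)" by auto
    moreover have "(\<Union>r\<in>{0, 1, 2}. K r) = K 0 \<union> K 1 \<union> K 2" by auto
    ultimately show "K r1 \<union> K r2 \<union> K r3 = I" using that(2) by simp
    have *: "K r \<inter> K r' = {}" if "r \<in> {0, 1, 2}" "r' \<in> {0, 1, 2}" "r \<noteq> r'" for r r'
      using that by (auto simp: K_def; presburger)
    have "r1 \<in> {0, 1, 2}" "r2 \<in> {0, 1, 2}" "r3 \<in> {0, 1, 2}" using that(2) by auto
    with that(1) show "K r1 \<inter> K r2 = {}" "K r1 \<inter> K r3 = {}" "K r2 \<inter> K r3 = {}"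
      using * by simp_all
  qed
  have 113: ?thesis if "distinct [r1, r2, r3]" "{r1, r2, r3} = {0, 1, 2}"
     "card (K r1) = 1" "card (K r2) = 1" "card (K r3) = 3" for r1 r2 r3
  proof (rule split_three_classes_113[where w = w and C = C, OF I[OF that(1,2)] disj[OF that(1,2)] that(3-5) z z z w1 sumw sumw sumw s3 s3 s3])
    have "r1 \<in> {0, 1, 2}" "r2 \<in> {0, 1, 2}" "r3 \<in> {0, 1, 2}" using that(2) by auto
    with that(1) show "s r1 \<noteq> s r2" "s r1 \<noteq> s r3" "s r2 \<noteq> s r3" by (auto intro!: s_ne)
  qed
  have 122: ?thesis if "distinct [r1, r2, r3]" "{r1, r2, r3} = {0, 1, 2}"
     "card (K r1) = 1" "card (K r2) = 2" "card (K r3) = 2" for r1 r2 r3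
  proof (rule split_three_classes_122[where w = w and C = C, OF I[OF that(1,2)] disj[OF that(1,2)] that(3-5) z z z w1 sumw sumw sumw s3 s3 s3])
    have "r1 \<in> {0, 1, 2}" "r2 \<in> {0, 1, 2}" "r3 \<in> {0, 1, 2}" using that(2) by auto
    with that(1) show "s r1 \<noteq> s r2" "s r1 \<noteq> s r3" "s r2 \<noteq> s r3" by (auto intro!: s_ne)
  qed
  have d: "distinct [0, 1, 2 :: int]" "{0, 1, 2 :: int} = {0, 1, 2}" by auto
  have "card (K 0) + card (K 1) + card (K 2) = 5"
  proof -
    have "card I = card (K 0 \<union> K 1) + card (K 2)"
      using I[OF d] disj[OF d] finK by (subst card_Un_disjoint[symmetric]) auto
    also have "card (K 0 \<union> K 1) = card (K 0) + card (K 1)"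
      using disj[OF d] finK by (intro card_Un_disjoint) auto
    finally show ?thesis using fin(2) by simp
  qed
  moreover from this have "card (K 0) = 1 \<or> card (K 0) = 2 \<or> card (K 0) = 3"
      "card (K 1) = 1 \<or> card (K 1) = 2 \<or> card (K 1) = 3"
    using ne[of 0] ne[of 1] ne[of 2] by linarith+
  ultimately consider "card (K 0) = 1" "card (K 1) = 1" "card (K 2) = 3"
    | "card (K 0) = 1" "card (K 1) = 3" "card (K 2) = 1" | "card (K 0) = 3" "card (K 1) = 1" "card (K 2) = 1"
    | "card (K 0) = 1" "card (K 1) = 2" "card (K 2) = 2" | "card (K 0) = 2" "card (K 1) = 1" "card (K 2) = 2"
    | "card (K 0) = 2" "card (K 1) = 2" "card (K 2) = 1"
    using ne[of 2] by (elim disjE) auto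
  then show ?thesis
  proof cases
    case 1 then show ?thesis by (intro 113[of 0 1 2]) auto
  next
    case 2 then show ?thesis by (intro 113[of 0 2 1]) auto
  next
    case 3 then show ?thesis by (intro 113[of 1 2 0]) auto
  next
    case 4 then show ?thesis by (intro 122[of 0 1 2]) auto
  next
    case 5 then show ?thesis by (intro 122[of 1 0 2]) auto
  next
    case 6 then show ?thesis by (intro 122[of 2 0 1]) auto
  qed
qed

lemma two_three_split_scale:
  assumes "two_three_split I w" and c: "c \<noteq> 0" "\<And>i. i \<in> I \<Longrightarrow> z i = c * w i"
  shows "two_three_split I z"
proof -
  obtain P where P: "P \<subseteq> I" "card P = 2" "\<And>i j. i \<in> P \<Longrightarrow> j \<in> P \<Longrightarrow> i \<noteq> j \<Longrightarrow> w i = - w j"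
    "\<And>i j. i \<in> I - P \<Longrightarrow> j \<in> I - P \<Longrightarrow> i \<noteq> j \<Longrightarrow> w i ^ 3 = w j ^ 3 \<and> w i \<noteq> w j"
    using assms(1) unfolding two_three_split_def by metis
  show ?thesis
    unfolding two_three_split_def
  proof (intro exI[of _ P] conjI ballI impI)
    fix i j assume "i \<in> P" "j \<in> P" "i \<noteq> j"
    then show "z i = - z j" using P(1) P(3)[of i j] c(2)[of i] c(2)[of j] by (simp add: subset_iff)
  next
    fix i j assume "i \<in> I - P" "j \<in> I - P" "i \<noteq> j"
    then show "z i ^ 3 = z j ^ 3" "z i \<noteq> z j"
      using P(4)[of i j] c by (simp_all add: power_mult_distrib)
  qed (use P in auto)
qed

text \<open>Induction on the order. If all exponents agree modulo \<open>p\<close>, a rotation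
  reduces \<open>n\<close> to \<open>n / p\<close>. Otherwise \<open>C = 0\<close> yields a proper
  part with sum zero, while a nonzero \<open>C\<close> makes every residue class modulo
  \<open>p\<close> nonempty, so \<open>p\<close> is at most 5; then 3 leads to the class sums above
  and 5 to one root per class.\<close>

lemma five_roots_of_unity_sum_zero:
  fixes a :: "'i \<Rightarrow> int"
  assumes "finite I" "card I = 5" "0 < n" "(\<Sum>i\<in>I. unity_root n (a i)) = 0"
  shows "(\<forall>i\<in>I. \<forall>j\<in>I. i \<noteq> j \<longrightarrow> unity_root n (a i) ^ 5 = unity_root n (a j) ^ 5 \<and> unity_root n (a i) \<noteq> unity_root n (a j))
       \<or> two_three_split I (\<lambda>i. unity_root n (a i))" (is "?fifth n a \<or> _")
  using assms(3,4)
proof (induction "nat n" arbitrary: n a rule: less_induct)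
  case less
  note n = less.prems(1) and sum = less.prems(2)
  define z where "z i = unity_root n (a i)" for i
  have sumz: "sum z I = 0" using sum by (simp add: z_def)
  have z1: "cmod (z i) = 1" for i by (simp add: z_def)
  show ?case
  proof (cases "n dvd 2")
    case True
    have "z i = 1 \<or> z i = - 1" for i
    proof -
      have "z i ^ 2 = 1" using True n by (simp add: z_def unity_root_power unity_root_eq_1_iff)
      then show ?thesis by (simp add: power2_eq_1_iff)
    qed
    then have "sum z I \<noteq> 0" using assms(1,2) by (intro sum_odd_signs_nonzero) auto
    then show ?thesis using sumz by simp
  next
    case False
    obtain p where p: "prime p" "int p dvd n" "p \<noteq> 2 \<or> 4 dvd n"
      using exists_useful_prime[OF n False] by blast
    have p0: "0 < p" using p(1) by (rule prime_gt_0_nat)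
    have I0: "I \<noteq> {}" using assms(2) by auto
    show ?thesis
    proof (cases "\<exists>r. \<forall>i\<in>I. int p dvd a i - r")
      case True
      then obtain r where r: "\<And>i. i \<in> I \<Longrightarrow> int p dvd a i - r" by blast
      obtain m where m: "n = int p * m" using p(2) by (auto elim: dvdE)
      have m0: "0 < m" using n m p0 by (simp add: zero_less_mult_iff)
      have mn: "m < n" using m m0 prime_gt_1_nat[OF p(1)] by simp
      define b where "b i = (a i - r) div int p" for i
      have zb: "unity_root n (a i) = unity_root n r * unity_root m (b i)" if "i \<in> I" for i
      proof -
        have "a i = r + int p * b i" using r[OF that] by (simp add: b_def)
        then show ?thesis using p0 by (simp add: unity_root_add m unity_root_scale)
      qed
      have "unity_root n r * (\<Sum>i\<in>I. unity_root m (b i)) = (\<Sum>i\<in>I. unity_root n (a i))"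
        unfolding sum_distrib_left by (intro sum.cong refl) (simp add: zb)
      then have "(\<Sum>i\<in>I. unity_root m (b i)) = 0" using sum by simp
      from less.hyps[OF _ m0 this] mn n have IH: "?fifth m b \<or> two_three_split I (\<lambda>i. unity_root m (b i))"
        by simp
      then show ?thesis
      proof
        assume IH5: "?fifth m b"
        have "?fifth n a"
        proof (intro ballI impI)
          fix i j assume ij: "i \<in> I" "j \<in> I" "i \<noteq> j"
          with IH5 have "unity_root m (b i) ^ 5 = unity_root m (b j) ^ 5" "unity_root m (b i) \<noteq> unity_root m (b j)"
            by blast+
          then show "unity_root n (a i) ^ 5 = unity_root n (a j) ^ 5 \<and> unity_root n (a i) \<noteq> unity_root n (a j)"
            unfolding zb[OF ij(1)] zb[OF ij(2)] by (simp add: power_mult_distrib)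
        qed
        then show ?thesis ..
      next
        assume "two_three_split I (\<lambda>i. unity_root m (b i))"
        then have "two_three_split I (\<lambda>i. unity_root n (a i))"
          by (rule two_three_split_scale) (simp_all add: zb)
        then show ?thesis ..
      qed
    next
      case notall: False
      obtain C k0 where k0: "\<not> int p dvd k0" and C: "(int p)\<^sup>2 dvd n \<Longrightarrow> C = 0"
        and classes: "\<And>r. (\<Sum>i | i \<in> I \<and> int p dvd a i - r. unity_root n (a i)) = unity_root (int p) (- (r * k0)) * C"
        using residue_class_sums[OF n p(1,2) assms(1) sum] by blast
      show ?thesis
      proof (cases "C = 0")
        case True
        obtain i0 where i0: "i0 \<in> I" using I0 by auto
        let ?K = "{i \<in> I. int p dvd a i - a i0}"
        have "two_three_split I z"
        proof (rule two_three_split_partial_sum[where K = ?K])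
          show "sum z ?K = 0" using classes[of "a i0"] True by (simp add: z_def)
          show "?K \<noteq> {}" using i0 by auto
          show "?K \<noteq> I" using notall by blast
        qed (use assms sumz z1 in auto)
        moreover have "z = (\<lambda>i. unity_root n (a i))" by (simp add: z_def fun_eq_iff)
        ultimately show ?thesis by simp
      next
        case False
        have p2: "p \<noteq> 2" using p(3) C False by (auto simp: power2_eq_square)
        have img: "(\<lambda>i. a i mod int p) ` I = {0..<int p}"
        proof (intro equalityI subsetI)
          fix r assume r: "r \<in> {0..<int p}"
          have "(\<Sum>i | i \<in> I \<and> int p dvd a i - r. unity_root n (a i)) \<noteq> 0" using classes[of r] False by simp
          then have "{i. i \<in> I \<and> int p dvd a i - r} \<noteq> {}" by force
          then obtain i where "i \<in> I" "int p dvd a i - r" by blast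
          then have "a i mod int p = r" using r by (simp add: mod_eq_dvd_iff[symmetric])
          then show "r \<in> (\<lambda>i. a i mod int p) ` I" using \<open>i \<in> I\<close> by blast
        qed (use p0 in auto)
        then have "p \<le> 5" using card_image_le[OF assms(1), of "\<lambda>i. a i mod int p"] assms(2) by simp
        moreover have "p \<noteq> 4" using p(1) prime_product[of 2 2] by auto
        ultimately have "p = 3 \<or> p = 5"
          using p2 prime_ge_2_nat[OF p(1)] by linarith
        then show ?thesis
        proof
          assume p3: "p = 3"
          have "two_three_split I (\<lambda>i. unity_root n (a i))"
            using five_roots_classes_mod_3[where I = I and k\<^sub>0 = k0 and C = C and a = a and n = n] assms(1,2) False k0 classes p3 by simp
          then show ?thesis ..
        next
          assume p5: "p = 5"
          have inj: "inj_on (\<lambda>i. a i mod 5) I"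
            using img assms(1,2) p5 by (intro eq_card_imp_inj_on) simp_all
          have z: "unity_root n (a i) = unity_root 5 (- (a i * k0)) * C" if "i \<in> I" for i
          proof -
            have "{j. j \<in> I \<and> 5 dvd a j - a i} = {i}"
              using that inj by (auto simp: inj_on_def mod_eq_dvd_iff)
            then show ?thesis using classes[of "a i"] p5 by simp
          qed
          have "?fifth n a"
          proof (intro ballI impI conjI)
            fix i j assume ij: "i \<in> I" "j \<in> I" "i \<noteq> j"
            show "unity_root n (a i) ^ 5 = unity_root n (a j) ^ 5"
              using ij by (simp add: z power_mult_distrib unity_root_power unity_root_eq_iff)
            show "unity_root n (a i) \<noteq> unity_root n (a j)"
            proof
              assume "unity_root n (a i) = unity_root n (a j)"
              then have "unity_root 5 (- (a i * k0)) = unity_root 5 (- (a j * k0))"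
                using ij False by (simp add: z)
              then have "5 dvd (a j - a i) * k0" by (simp add: unity_root_eq_iff left_diff_distrib)
              moreover have "prime (5 :: int)" by simp
              ultimately have "5 dvd a j - a i" using k0 p5 by (metis of_nat_numeral prime_dvd_mult_iff)
              then have "a j mod 5 = a i mod 5" by (simp add: mod_eq_dvd_iff)
              then show False using inj ij by (auto simp: inj_on_def)
            qed
          qed
          then show ?thesis ..
        qed
      qed
    qed
  qed
qed

section \<open>The valuations of a Hadamard pair\<close>

lemma multiplicity_add_ge:
  fixes a b p :: int
  assumes "prime p" "a + b \<noteq> 0" "k \<le> multiplicity p a" "k \<le> multiplicity p b"
  shows "k \<le> multiplicity p (a + b)"
proof -
  have "p ^ k dvd a + b" using assms(3,4) by (intro dvd_add multiplicity_dvd')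
  then show ?thesis using assms(1,2) by (intro multiplicity_geI) (auto simp: not_prime_unit)
qed

lemma multiplicity_add_eq:
  fixes a b p :: int
  assumes "prime p" "a \<noteq> 0" "a + b \<noteq> 0" "multiplicity p a < multiplicity p b"
  shows "multiplicity p (a + b) = multiplicity p a"
proof (rule ccontr)
  let ?k = "multiplicity p a"
  assume "multiplicity p (a + b) \<noteq> ?k"
  moreover have "?k \<le> multiplicity p (a + b)" using assms by (intro multiplicity_add_ge) auto
  ultimately have "Suc ?k \<le> multiplicity p (a + b)" by simp
  moreover have "Suc ?k \<le> multiplicity p (- b)"
    using assms(4) multiplicity_times_unit_right[of "- 1" p b] by simp
  ultimately have "Suc ?k \<le> multiplicity p ((a + b) + - b)"
    using multiplicity_add_ge[of p "a + b" "- b" "Suc ?k"] assms(1,2) by simp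
  then show False by simp
qed

text \<open>The odd parts add up to an even number. Hence the three differences of three distinct
  integers never share one 2-adic valuation.\<close>

lemma multiplicity_2_add:
  fixes a b :: int
  assumes "a \<noteq> 0" "b \<noteq> 0" "a + b \<noteq> 0" "multiplicity 2 a = multiplicity 2 b"
  shows "multiplicity 2 (a + b) \<noteq> multiplicity 2 a"
proof
  assume eq: "multiplicity 2 (a + b) = multiplicity 2 a"
  obtain a' where a': "a = 2 ^ multiplicity 2 a * a'" "odd a'"
    using multiplicity_decompose'[of a 2] assms(1) by auto
  obtain b' where b': "b = 2 ^ multiplicity 2 a * b'" "odd b'"
    using multiplicity_decompose'[of b 2] assms(2,4) by auto
  have "even (a' + b')" using a'(2) b'(2) by simp
  then obtain c where "a' + b' = 2 * c" by (rule evenE)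
  moreover have "a + b = 2 ^ multiplicity 2 a * (a' + b')" using a'(1) b'(1) by (simp add: distrib_left)
  ultimately have "2 ^ Suc (multiplicity 2 a) dvd a + b" by simp
  then have "Suc (multiplicity 2 a) \<le> multiplicity 2 (a + b)"
    using assms(3) by (intro multiplicity_geI) simp_all
  then show False using eq by simp
qed

text \<open>The part of \<open>R\<close> prime to \<open>p\<close> divides \<open>x\<close> already,
  so what \<open>x\<close> lacks is exactly one factor \<open>p\<close>.\<close>

lemma multiplicity_exact_quotient:
  fixes p R x :: int
  assumes "prime p" "R \<noteq> 0" "x \<noteq> 0" "R dvd p * x" "\<not> R dvd x"
  shows "multiplicity p R = Suc (multiplicity p x)"
proof -
  have p: "p \<noteq> 0" "\<not> is_unit p" using assms(1) by auto
  have "multiplicity p R \<le> multiplicity p (p * x)"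
    using assms p by (intro dvd_imp_multiplicity_le) simp_all
  then have "multiplicity p R \<le> Suc (multiplicity p x)"
    by (simp only: multiplicity_times_same[OF assms(3) p(2) p(1)])
  moreover have "\<not> multiplicity p R \<le> multiplicity p x"
  proof
    assume le: "multiplicity p R \<le> multiplicity p x"
    obtain R' where R': "R = p ^ multiplicity p R * R'" "\<not> p dvd R'"
      using multiplicity_decompose'[OF assms(2) p(2)] by blast
    have cop: "coprime R' p" using R'(2) assms(1) by (metis coprime_commute prime_imp_coprime)
    have "R' dvd p * x" using R'(1) assms(4) by (metis dvd_mult_right)
    then have "R' dvd x" using cop by (simp add: coprime_dvd_mult_right_iff)
    moreover have "p ^ multiplicity p R dvd x" using le by (rule multiplicity_dvd')
    ultimately have "p ^ multiplicity p R * R' dvd x"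
      using cop by (intro divides_mult) (simp_all add: coprime_commute)
    then show False using assms(5) R'(1) by simp
  qed
  ultimately show ?thesis by simp
qed

section \<open>Hadamard pairs as vanishing character sums\<close>

text \<open>The diagonal unitarity relations are automatic and the others involve only differences;
  what remains after removing the normalisation is visibly symmetric in \<open>B\<close> and
  \<open>L\<close>.\<close>

lemma hadamard_pair_iff:
  "hadamard_pair R B L \<longleftrightarrow>
     2 \<le> R \<and> finite B \<and> finite L \<and> 0 \<in> B \<and> 0 \<in> L \<and> card B = card L \<and>
     (\<forall>b\<in>B. \<forall>b'\<in>B. b \<noteq> b' \<longrightarrow> (\<Sum>l\<in>L. unity_root R ((b - b') * l)) = 0) \<and>
     (\<forall>l\<in>L. \<forall>l'\<in>L. l \<noteq> l' \<longrightarrow> (\<Sum>b\<in>B. unity_root R (b * (l - l'))) = 0)"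
proof -
  define U where "U = (\<lambda>b l. complex_of_real (1 / sqrt (real (card B))) *
    cis (2 * pi * real_of_int b * real_of_int l / real_of_int R))"
  have U: "U b l = complex_of_real (1 / sqrt (real (card B))) * unity_root R (b * l)" for b l
    by (simp add: U_def unity_root_def mult.assoc)
  have "unitary_matrix B L U \<longleftrightarrow>
     (\<forall>b\<in>B. \<forall>b'\<in>B. b \<noteq> b' \<longrightarrow> (\<Sum>l\<in>L. unity_root R ((b - b') * l)) = 0) \<and>
     (\<forall>l\<in>L. \<forall>l'\<in>L. l \<noteq> l' \<longrightarrow> (\<Sum>b\<in>B. unity_root R (b * (l - l'))) = 0)"
    if "finite B" "finite L" "0 \<in> B" "card B = card L"
  proof -
    have N: "card B \<noteq> 0" "card L \<noteq> 0" using that by auto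
    define c where "c = complex_of_real (1 / sqrt (real (card B)))"
    have c: "c * c = 1 / of_nat (card B)" "cnj c = c" "U b l = c * unity_root R (b * l)" for b l
      by (simp_all add: c_def U flip: of_real_mult)
    have row: "(\<Sum>l\<in>L. U b l * cnj (U b' l)) = (\<Sum>l\<in>L. unity_root R ((b - b') * l)) / of_nat (card B)" for b b'
    proof -
      have "U b l * cnj (U b' l) = (c * c) * unity_root R (b * l + - (b' * l))" for l
        by (simp only: c(2,3) complex_cnj_mult cnj_unity_root unity_root_add mult_ac)
      then show ?thesis by (simp add: c(1) sum_divide_distrib left_diff_distrib)
    qed
    have col: "(\<Sum>b\<in>B. cnj (U b l) * U b l') = (\<Sum>b\<in>B. unity_root R (b * (l' - l))) / of_nat (card B)" for l l'
    proof -
      have "cnj (U b l) * U b l' = (c * c) * unity_root R (b * l' + - (b * l))" for b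
        by (simp only: c(2,3) complex_cnj_mult cnj_unity_root unity_root_add mult_ac)
      then show ?thesis by (simp add: c(1) sum_divide_distrib right_diff_distrib)
    qed
    show ?thesis
      unfolding unitary_matrix_def row col using N that(4) by (auto 0 3 split: if_splits)
  qed
  then show ?thesis unfolding hadamard_pair_def U_def by blast
qed

lemma multiplicity_diff_commute:
  fixes p x y :: int
  shows "multiplicity p (x - y) = multiplicity p (y - x)"
  using multiplicity_times_unit_right[of "- 1" p "y - x"] by simp

lemma hadamard_pair_sym: "hadamard_pair R B L \<Longrightarrow> hadamard_pair R L B"
  unfolding hadamard_pair_iff by (simp add: mult.commute)

definition valuations :: "int \<Rightarrow> int set \<Rightarrow> nat set" where
  "valuations p B = {multiplicity p (b - b') | b b'. b \<in> B \<and> b' \<in> B \<and> b \<noteq> b'}"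

text \<open>Read from the lowest base \<open>p\<close> digit upward, two elements of
  \<open>B\<close> first differ at a position in \<open>S\<close>, two elements of \<open>L\<close>
  at a mirrored one. Inclusions suffice because the size \<open>p ^ card S\<close> later turns
  distinct residues into a complete system by counting.\<close>

definition digit_structured :: "int \<Rightarrow> int \<Rightarrow> nat set \<Rightarrow> int set \<Rightarrow> int set \<Rightarrow> bool" where
  "digit_structured R p S B L \<longleftrightarrow> prime p \<and> S \<subseteq> {..<multiplicity p R} \<and> card B = nat p ^ card S \<and>
     valuations p B \<subseteq> S \<and> valuations p L \<subseteq> (\<lambda>s. multiplicity p R - 1 - s) ` S"

lemma two_distinct_elements:
  assumes "2 \<le> card B"
  obtains b b' where "b \<in> B" "b' \<in> B" "b \<noteq> b'"
  using assms card_le_Suc0_iff_eq[of B] that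
  by (metis One_nat_def Suc_n_not_le_n card.infinite le_trans not_less_eq_eq numeral_2_eq_2 zero_le)

lemma three_distinct_elements:
  assumes "3 \<le> card B"
  obtains x y z where "x \<in> B" "y \<in> B" "z \<in> B" "x \<noteq> y" "y \<noteq> z" "x \<noteq> z"
proof -
  obtain T where "T \<subseteq> B" "card T = 3" using assms by (metis obtain_subset_with_card_n)
  then show ?thesis using that by (auto simp: card_3_iff)
qed

text \<open>The quotient of the two roots is a primitive \<open>p\<close>-th root of unity, so
  \<open>(b - b') * D\<close> falls short of a multiple of \<open>R\<close> by exactly one factor
  \<open>p\<close>. This is the origin of the \<open>- 1\<close> in the mirror image.\<close>

lemma unity_root_power_eq_valuation:
  assumes "prime p" "R \<noteq> 0" "b \<noteq> b'" "D \<noteq> 0"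
    and "unity_root R (b * D) ^ nat p = unity_root R (b' * D) ^ nat p" "unity_root R (b * D) \<noteq> unity_root R (b' * D)"
  shows "multiplicity p R = Suc (multiplicity p (b - b') + multiplicity p D)"
proof -
  have p0: "0 \<le> p" using assms(1) by (simp add: prime_ge_0_int)
  have "R dvd p * ((b - b') * D)" "\<not> R dvd (b - b') * D"
    using assms(2,5,6) p0 by (simp_all add: unity_root_power unity_root_eq_iff algebra_simps)
  then show ?thesis
    using multiplicity_exact_quotient[of p R "(b - b') * D"] assms(1-4)
      prime_elem_multiplicity_mult_distrib[OF prime_imp_prime_elem[OF assms(1)], of "b - b'" D] by simp
qed

text \<open>The valuations of a difference in \<open>B\<close> and one in \<open>L\<close> have a
  constant sum. Fixing either difference makes all valuations on the other side equal, so
  \<open>S\<close> is a single position.\<close>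

lemma digit_structured_prime_size:
  assumes hp: "hadamard_pair R B L" and p: "prime p" "card B = nat p"
    and pth: "\<And>b b' l l'. b \<in> B \<Longrightarrow> b' \<in> B \<Longrightarrow> b \<noteq> b' \<Longrightarrow> l \<in> L \<Longrightarrow> l' \<in> L \<Longrightarrow> l \<noteq> l' \<Longrightarrow>
      unity_root R (b * (l - l')) ^ nat p = unity_root R (b' * (l - l')) ^ nat p \<and>
      unity_root R (b * (l - l')) \<noteq> unity_root R (b' * (l - l'))"
  shows "\<exists>S. digit_structured R p S B L"
proof -
  have R: "R \<noteq> 0" and cards: "card B = card L" using hp by (auto simp: hadamard_pair_iff)
  have p2: "2 \<le> nat p" using prime_ge_2_int[OF p(1)] by simp
  have key: "multiplicity p R = Suc (multiplicity p (b - b') + multiplicity p (l - l'))"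
    if "b \<in> B" "b' \<in> B" "b \<noteq> b'" "l \<in> L" "l' \<in> L" "l \<noteq> l'" for b b' l l'
    using unity_root_power_eq_valuation[OF p(1) R that(3), of "l - l'"] pth[OF that] that(6) by simp
  obtain b b' where b: "b \<in> B" "b' \<in> B" "b \<noteq> b'" using two_distinct_elements[of B] p p2 by auto
  obtain l l' where l: "l \<in> L" "l' \<in> L" "l \<noteq> l'" using two_distinct_elements[of L] p p2 cards by auto
  have "digit_structured R p {multiplicity p (b - b')} B L"
    unfolding digit_structured_def
  proof (intro conjI)
    show "valuations p B \<subseteq> {multiplicity p (b - b')}"
    proof
      fix s assume "s \<in> valuations p B"
      then obtain x y where "s = multiplicity p (x - y)" "x \<in> B" "y \<in> B" "x \<noteq> y" by (auto simp: valuations_def)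
      then show "s \<in> {multiplicity p (b - b')}" using key[OF b l] key[OF _ _ _ l, of x y] by simp
    qed
    show "valuations p L \<subseteq> (\<lambda>s. multiplicity p R - 1 - s) ` {multiplicity p (b - b')}"
    proof
      fix s assume "s \<in> valuations p L"
      then obtain x y where "s = multiplicity p (x - y)" "x \<in> L" "y \<in> L" "x \<noteq> y" by (auto simp: valuations_def)
      then show "s \<in> (\<lambda>s. multiplicity p R - 1 - s) ` {multiplicity p (b - b')}" using key[OF b, of x y] by simp
    qed
  qed (use p key[OF b l] in simp_all)
  then show ?thesis ..
qed

section \<open>Sizes two, three and four\<close>

lemma digit_structured_card_2:
  assumes hp: "hadamard_pair R B L" and card: "card B = 2"
  shows "\<exists>S. digit_structured R 2 S B L"
proof (rule digit_structured_prime_size[OF hp])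
  fix b b' l l' assume *: "b \<in> B" "b' \<in> B" "b \<noteq> b'" "l \<in> L" "l' \<in> L" "l \<noteq> l'"
  then have "B = {b, b'}" using card by (auto simp: card_2_iff)
  moreover have "(\<Sum>b\<in>B. unity_root R (b * (l - l'))) = 0" using hp * by (simp add: hadamard_pair_iff)
  ultimately have "unity_root R (b * (l - l')) = - unity_root R (b' * (l - l'))"
    using *(3) by (simp add: eq_neg_iff_add_eq_0)
  then show "unity_root R (b * (l - l')) ^ nat 2 = unity_root R (b' * (l - l')) ^ nat 2 \<and>
      unity_root R (b * (l - l')) \<noteq> unity_root R (b' * (l - l'))" by simp
qed (use card in simp_all)

lemma digit_structured_card_3:
  assumes hp: "hadamard_pair R B L" and card: "card B = 3"
  shows "\<exists>S. digit_structured R 3 S B L"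
proof (rule digit_structured_prime_size[OF hp])
  fix b b' l l' assume *: "b \<in> B" "b' \<in> B" "b \<noteq> b'" "l \<in> L" "l' \<in> L" "l \<noteq> l'"
  have "finite B" using hp by (simp add: hadamard_pair_iff)
  then have "card (B - {b, b'}) = 1" using card * by (simp add: card_Diff_subset)
  then obtain c where "B - {b, b'} = {c}" by (auto simp: card_1_singleton_iff)
  then have c: "B = {b, b', c}" "c \<noteq> b" "c \<noteq> b'" using * by auto
  have "(\<Sum>b\<in>B. unity_root R (b * (l - l'))) = 0" using hp * by (simp add: hadamard_pair_iff)
  then have sum: "unity_root R (b * (l - l')) + unity_root R (b' * (l - l')) + unity_root R (c * (l - l')) = 0"
    using c *(3) by (simp add: add.assoc)
  show "unity_root R (b * (l - l')) ^ nat 3 = unity_root R (b' * (l - l')) ^ nat 3 \<and>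
      unity_root R (b * (l - l')) \<noteq> unity_root R (b' * (l - l'))"
    using three_unit_sum_zero[OF _ _ _ sum] by simp
qed (use card in simp_all)

text \<open>Four unit numbers with sum zero form two antipodal pairs, and one of these pairs lies in any
  given three of them.\<close>

lemma hadamard_pair_card_4_triangle:
  assumes hp: "hadamard_pair R B L" and card: "card B = 4"
    and t: "t1 \<in> B" "t2 \<in> B" "t3 \<in> B" "t1 \<noteq> t2" "t2 \<noteq> t3" "t1 \<noteq> t3"
    and l: "l \<in> L" "l' \<in> L" "l \<noteq> l'"
  shows "\<exists>s \<in> {multiplicity 2 (t1 - t2), multiplicity 2 (t2 - t3), multiplicity 2 (t1 - t3)}.
    multiplicity 2 R = Suc (s + multiplicity 2 (l - l'))"
proof -
  have fin: "finite B" and R: "R \<noteq> 0" using hp by (auto simp: hadamard_pair_iff)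
  have "card (B - {t1, t2, t3}) = 1" using card fin t by (simp add: card_Diff_subset)
  then obtain c where "B - {t1, t2, t3} = {c}" by (auto simp: card_1_singleton_iff)
  then have c: "B = {t1, t2, t3, c}" "c \<noteq> t1" "c \<noteq> t2" "c \<noteq> t3" using t by auto
  define z where "z b = unity_root R (b * (l - l'))" for b
  have "(\<Sum>b\<in>B. z b) = 0" using hp l by (simp add: hadamard_pair_iff z_def)
  then have sum: "z t1 + z t2 + z t3 + z c = 0" using c t by (simp add: add.assoc)
  have z1: "cmod (z b) = 1" for b by (simp add: z_def)
  have val: "multiplicity 2 R = Suc (multiplicity 2 (x - y) + multiplicity 2 (l - l'))"
    if "z x = - z y" "x \<noteq> y" for x y
    using unity_root_power_eq_valuation[of 2 R x y "l - l'"] that R l(3) by (simp add: z_def)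
  have "z t2 = - z t3" if "z t1 = - z c"
    using sum that by (simp add: eq_neg_iff_add_eq_0)
  with four_unit_sum_zero[OF z1 z1 z1 z1 sum]
  consider "z t1 = - z t2" | "z t1 = - z t3" | "z t2 = - z t3" by blast
  then show ?thesis
    by cases (use val t in blast)+
qed

text \<open>\<open>S\<close> is read off one triangle in \<open>B\<close>. A difference in
  \<open>B\<close> finds a partner in a triangle of \<open>L\<close>, and this partner finds one in
  the triangle of \<open>B\<close>; comparing the two equations puts the given valuation into
  \<open>S\<close>.\<close>

lemma digit_structured_card_4:
  assumes hp: "hadamard_pair R B L" and card: "card B = 4"
  shows "\<exists>S. digit_structured R 2 S B L"
proof -
  have hp': "hadamard_pair R L B" using hp by (rule hadamard_pair_sym)
  have card': "card L = 4" using hp card by (simp add: hadamard_pair_iff)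
  obtain t1 t2 t3 where t: "t1 \<in> B" "t2 \<in> B" "t3 \<in> B" "t1 \<noteq> t2" "t2 \<noteq> t3" "t1 \<noteq> t3"
    using three_distinct_elements[of B] card by auto
  obtain u1 u2 u3 where u: "u1 \<in> L" "u2 \<in> L" "u3 \<in> L" "u1 \<noteq> u2" "u2 \<noteq> u3" "u1 \<noteq> u3"
    using three_distinct_elements[of L] card' by auto
  define S where "S = {multiplicity 2 (t1 - t2), multiplicity 2 (t2 - t3), multiplicity 2 (t1 - t3)}"
  note triB = hadamard_pair_card_4_triangle[OF hp card t, folded S_def]
  have S_val: "S \<subseteq> valuations 2 B" using t unfolding S_def valuations_def by blast
  have VB: "valuations 2 B \<subseteq> S" "valuations 2 B \<subseteq> {..<multiplicity 2 R}"
  proof -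
    have "s \<in> S \<and> s < multiplicity 2 R" if "s \<in> valuations 2 B" for s
    proof -
      obtain b b' where b: "s = multiplicity 2 (b - b')" "b \<in> B" "b' \<in> B" "b \<noteq> b'"
        using \<open>s \<in> valuations 2 B\<close> by (auto simp: valuations_def)
      from hadamard_pair_card_4_triangle[OF hp' card' u b(2-4)]
      obtain l l' where l: "l \<in> L" "l' \<in> L" "l \<noteq> l'" "multiplicity 2 R = Suc (multiplicity 2 (l - l') + s)"
        using u b(1) by blast
      then show ?thesis using triB[OF l(1-3)] by auto
    qed
    then show "valuations 2 B \<subseteq> S" "valuations 2 B \<subseteq> {..<multiplicity 2 R}" by auto
  qed
  have VL: "valuations 2 L \<subseteq> (\<lambda>s. multiplicity 2 R - 1 - s) ` S"
  proof
    fix s assume "s \<in> valuations 2 L"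
    then obtain l l' where l: "s = multiplicity 2 (l - l')" "l \<in> L" "l' \<in> L" "l \<noteq> l'"
      by (auto simp: valuations_def)
    then obtain s' where "s' \<in> S" "multiplicity 2 R = Suc (s' + s)" using triB by blast
    then show "s \<in> (\<lambda>s. multiplicity 2 R - 1 - s) ` S" by (intro image_eqI[of _ _ s']) auto
  qed
  \<comment> \<open>The ultrametric inequality makes two of the three valuations agree, and parity
    forbids that all three do.\<close>
  have "card S = 2"
  proof -
    define x y where "x = t1 - t2" and "y = t2 - t3"
    have xy: "x \<noteq> 0" "y \<noteq> 0" "x + y \<noteq> 0" and S: "S = {multiplicity 2 x, multiplicity 2 y, multiplicity 2 (x + y)}"
      using t by (simp_all add: x_def y_def S_def)
    consider "multiplicity 2 x = multiplicity 2 y" | "multiplicity 2 x < multiplicity 2 y" | "multiplicity 2 y < multiplicity 2 x"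
      by linarith
    then show ?thesis
    proof cases
      case 1
      then show ?thesis using multiplicity_2_add[OF xy 1] by (simp add: S card_insert_if)
    next
      case 2
      then show ?thesis using multiplicity_add_eq[of 2 x y] xy by (simp add: S card_insert_if)
    next
      case 3
      then show ?thesis using multiplicity_add_eq[of 2 y x] xy by (simp add: S card_insert_if add.commute)
    qed
  qed
  then have "digit_structured R 2 S B L"
    using VB VL S_val card unfolding digit_structured_def by auto
  then show ?thesis ..
qed

section \<open>Size five\<close>

lemma two_three_split_valuations:
  assumes "R \<noteq> 0" "D \<noteq> 0" "two_three_split B (\<lambda>b. unity_root R (b * D))"
  obtains P where "P \<subseteq> B" "card P = 2"
    "\<And>b b'. b \<in> P \<Longrightarrow> b' \<in> P \<Longrightarrow> b \<noteq> b' \<Longrightarrow> R dvd 2 * ((b - b') * D)"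
    "\<And>b b'. b \<in> P \<Longrightarrow> b' \<in> P \<Longrightarrow> b \<noteq> b' \<Longrightarrow> \<not> R dvd (b - b') * D"
    "\<And>b b'. b \<in> B - P \<Longrightarrow> b' \<in> B - P \<Longrightarrow> b \<noteq> b' \<Longrightarrow> R dvd 3 * ((b - b') * D)"
proof -
  define z where "z b = unity_root R (b * D)" for b
  obtain P where P: "P \<subseteq> B" "card P = 2"
      "\<And>b b'. b \<in> P \<Longrightarrow> b' \<in> P \<Longrightarrow> b \<noteq> b' \<Longrightarrow> z b = - z b'"
      "\<And>b b'. b \<in> B - P \<Longrightarrow> b' \<in> B - P \<Longrightarrow> b \<noteq> b' \<Longrightarrow> z b ^ 3 = z b' ^ 3"
    using assms(3) unfolding two_three_split_def z_def[symmetric] by blast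
  have eq: "z b ^ t = z b' ^ t \<longleftrightarrow> R dvd int t * ((b - b') * D)" for b b' t
    using assms(1) by (simp add: z_def unity_root_power unity_root_eq_iff algebra_simps)
  show ?thesis
  proof (rule that[OF P(1,2)])
    fix b b' assume *: "b \<in> P" "b' \<in> P" "b \<noteq> b'"
    have "z b ^ 2 = z b' ^ 2" "z b \<noteq> z b'" using P(3)[OF *] by (simp_all add: z_def)
    then show "R dvd 2 * ((b - b') * D)" "\<not> R dvd (b - b') * D"
      using eq[of b 2 b'] eq[of b 1 b'] by simp_all
  next
    fix b b' assume *: "b \<in> B - P" "b' \<in> B - P" "b \<noteq> b'"
    then show "R dvd 3 * ((b - b') * D)" using P(4)[OF *] eq[of b 3 b'] by simp
  qed
qed

text \<open>If \<open>D'\<close> is 2-adically smaller than \<open>D\<close>, then modulo a suitable power of 2 the elements inside each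
  of \<open>P\<close>, \<open>B - P\<close> and \<open>B - P'\<close> agree, while those of \<open>P'\<close> do not; these are incompatible since \<open>B\<close> has
  five elements.\<close>

lemma two_three_split_valuation_not_less:
  assumes "R \<noteq> 0" "D \<noteq> 0" "D' \<noteq> 0" and fin: "finite B" "card B = 5"
    and split: "two_three_split B (\<lambda>b. unity_root R (b * D))"
    and split': "two_three_split B (\<lambda>b. unity_root R (b * D'))"
  shows "\<not> multiplicity 2 D < multiplicity 2 D'"
proof
  assume less: "multiplicity 2 D < multiplicity 2 D'"
  \<comment> \<open>Pairs in \<open>B - P'\<close> have 2-adic valuation at least \<open>c\<close>,
    pairs in \<open>P'\<close> exactly \<open>c - 1\<close>. The strict inequality between
    \<open>D\<close> and \<open>D'\<close> makes up for the same loss of 1 in \<open>P\<close>, so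
    pairs in \<open>P\<close> still reach \<open>c\<close>.\<close>
  define c where "c = multiplicity 2 R - multiplicity 2 D'"
  define near where "near x y \<longleftrightarrow> 2 ^ c dvd x - y" for x y :: int
  have near_sym: "near y x" if "near x y" for x y
    using that by (simp add: near_def dvd_diff_commute)
  have near_trans: "near x z" if "near x y" "near y z" for x y z
    using dvd_add[OF that[unfolded near_def]] by (simp add: near_def)
  have nearI: "near x y" if "x \<noteq> y \<Longrightarrow> c \<le> multiplicity 2 (x - y)" for x y
    using that by (cases "x = y") (auto simp: near_def intro: multiplicity_dvd')
  have mult: "multiplicity 2 ((x - y) * E) = multiplicity 2 (x - y) + multiplicity 2 E"
    if "x \<noteq> y" "E \<noteq> 0" for x y E :: int
    using prime_elem_multiplicity_mult_distrib[of 2 "x - y" E] that by simp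
  have exact: "multiplicity 2 R = Suc (multiplicity 2 (x - y) + multiplicity 2 E)"
    if "R dvd 2 * ((x - y) * E)" "\<not> R dvd (x - y) * E" "x \<noteq> y" "E \<noteq> 0" for x y E
    using multiplicity_exact_quotient[of 2 R "(x - y) * E"] that assms(1) mult[of x y E] by simp
  have le: "multiplicity 2 R \<le> multiplicity 2 (x - y) + multiplicity 2 E"
    if "R dvd 3 * ((x - y) * E)" "x \<noteq> y" "E \<noteq> 0" for x y E
  proof -
    have "multiplicity 2 R \<le> multiplicity 2 (3 * ((x - y) * E))"
      using that by (intro dvd_imp_multiplicity_le) simp_all
    also have "\<dots> = multiplicity 2 ((x - y) * E)"
      by (rule multiplicity_prime_elem_times_other) simp_all
    finally show ?thesis using mult that by simp
  qed
  obtain P where P: "P \<subseteq> B" "card P = 2"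
    "\<And>b b'. b \<in> P \<Longrightarrow> b' \<in> P \<Longrightarrow> b \<noteq> b' \<Longrightarrow> R dvd 2 * ((b - b') * D)"
    "\<And>b b'. b \<in> P \<Longrightarrow> b' \<in> P \<Longrightarrow> b \<noteq> b' \<Longrightarrow> \<not> R dvd (b - b') * D"
    "\<And>b b'. b \<in> B - P \<Longrightarrow> b' \<in> B - P \<Longrightarrow> b \<noteq> b' \<Longrightarrow> R dvd 3 * ((b - b') * D)"
    using two_three_split_valuations[OF assms(1,2) split] by blast
  obtain P' where P': "P' \<subseteq> B" "card P' = 2"
    "\<And>b b'. b \<in> P' \<Longrightarrow> b' \<in> P' \<Longrightarrow> b \<noteq> b' \<Longrightarrow> R dvd 2 * ((b - b') * D')"
    "\<And>b b'. b \<in> P' \<Longrightarrow> b' \<in> P' \<Longrightarrow> b \<noteq> b' \<Longrightarrow> \<not> R dvd (b - b') * D'"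
    "\<And>b b'. b \<in> B - P' \<Longrightarrow> b' \<in> B - P' \<Longrightarrow> b \<noteq> b' \<Longrightarrow> R dvd 3 * ((b - b') * D')"
    using two_three_split_valuations[OF assms(1,3) split'] by blast
  have nP: "near x y" if "x \<in> P" "y \<in> P" for x y
    using exact[of x y D] P(3,4) that assms(2) less by (intro nearI) (force simp: c_def)
  have nT: "near x y" if "x \<in> B - P" "y \<in> B - P" for x y
    using le[of x y D] P(5) that assms(2) less by (intro nearI) (force simp: c_def)
  have nT': "near x y" if "x \<in> B - P'" "y \<in> B - P'" for x y
    using le[of x y D'] P'(5) that assms(3) by (intro nearI) (force simp: c_def)
  obtain s t where st: "P' = {s, t}" "s \<noteq> t" using P'(2) by (auto simp: card_2_iff)
  have not_near: "\<not> near s t"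
  proof
    assume "near s t"
    then have "c \<le> multiplicity 2 (s - t)"
      unfolding near_def using st(2) by (intro multiplicity_geI) simp_all
    moreover have "multiplicity 2 R = Suc (multiplicity 2 (s - t) + multiplicity 2 D')"
      using exact[of s t D'] P'(3,4)[of s t] st assms(3) by simp
    ultimately show False by (simp add: c_def)
  qed
  \<comment> \<open>If \<open>P'\<close> takes one element from each part, the other element
    \<open>y\<close> of \<open>P\<close> and a second element \<open>u\<close> of
    \<open>B - P\<close> lie outside \<open>P'\<close> and link \<open>a\<close> to
    \<open>b\<close>.\<close>
  have cross: "near a b" if ab: "a \<in> P" "b \<in> B - P" "P' = {a, b}" for a b
  proof -
    have "card (P - {a}) = 1" using P(2) ab(1) by simp
    then obtain y where y: "P - {a} = {y}" by (auto simp: card_1_singleton_iff)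
    have "card (B - P - {b}) = 2"
      using fin P(1,2) ab(2) by (simp add: card_Diff_subset finite_subset)
    then obtain u where u: "u \<in> B - P - {b}" by (metis all_not_in_conv card.empty zero_neq_numeral)
    have "near a y" using nP ab(1) y by auto
    moreover have "near y u" using nT' y u P(1) ab by auto
    moreover have "near u b" using nT u ab(2) by auto
    ultimately show ?thesis using near_trans by blast
  qed
  have "s \<in> B" "t \<in> B" using P'(1) st(1) by auto
  then consider "s \<in> P" "t \<in> P" | "s \<in> B - P" "t \<in> B - P" | "s \<in> P" "t \<in> B - P" | "t \<in> P" "s \<in> B - P"
    by blast
  then have "near s t"
    by cases (use nP nT cross near_sym st(1) in \<open>auto simp: insert_commute\<close>)
  with not_near show False ..
qed

text \<open>The antipodal pair belonging to \<open>D\<close> decides: its difference times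
  \<open>2 * D\<close> is a multiple of \<open>R\<close>, while its difference times
  \<open>D'\<close> lacks exactly one factor 5.\<close>

lemma two_three_split_valuation_5:
  assumes "R \<noteq> 0" "D \<noteq> 0" "D' \<noteq> 0" and B: "card B = 5"
    and split: "two_three_split B (\<lambda>b. unity_root R (b * D))"
    and fifth: "\<And>b b'. b \<in> B \<Longrightarrow> b' \<in> B \<Longrightarrow> b \<noteq> b' \<Longrightarrow>
      unity_root R (b * D') ^ 5 = unity_root R (b' * D') ^ 5 \<and> unity_root R (b * D') \<noteq> unity_root R (b' * D')"
  shows "multiplicity 5 D' < multiplicity 5 D"
proof -
  obtain P where P: "P \<subseteq> B" "card P = 2"
    "\<And>b b'. b \<in> P \<Longrightarrow> b' \<in> P \<Longrightarrow> b \<noteq> b' \<Longrightarrow> R dvd 2 * ((b - b') * D)"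
      "\<And>b b'. b \<in> P \<Longrightarrow> b' \<in> P \<Longrightarrow> b \<noteq> b' \<Longrightarrow> \<not> R dvd (b - b') * D"
      "\<And>b b'. b \<in> B - P \<Longrightarrow> b' \<in> B - P \<Longrightarrow> b \<noteq> b' \<Longrightarrow> R dvd 3 * ((b - b') * D)"
    using two_three_split_valuations[OF assms(1,2) split] by blast
  obtain x y where xy: "P = {x, y}" "x \<noteq> y" using P(2) by (auto simp: card_2_iff)
  have "multiplicity 5 R = Suc (multiplicity 5 (x - y) + multiplicity 5 D')"
    using unity_root_power_eq_valuation[of 5 R x y D'] fifth[of x y] xy P(1) assms(1,3) by simp
  moreover have "multiplicity 5 R \<le> multiplicity 5 (2 * ((x - y) * D))"
    using P(3)[of x y] xy assms(2) by (intro dvd_imp_multiplicity_le) simp_all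
  moreover have "multiplicity 5 (2 * ((x - y) * D)) = multiplicity 5 ((x - y) * D)"
    by (rule multiplicity_prime_elem_times_other) simp_all
  moreover have "multiplicity 5 ((x - y) * D) = multiplicity 5 (x - y) + multiplicity 5 D"
    using prime_elem_multiplicity_mult_distrib[of 5 "x - y" D] xy assms(2) by simp
  ultimately show ?thesis by simp
qed

text \<open>A triangle in \<open>L\<close> admits no splitting among its differences. Three
  splittings contradict 2-adic parity; with exactly two, the third difference alone has the smallest
  5-adic valuation, against the ultrametric inequality; exactly one is excluded by
  \<open>not_T23\<close>.\<close>

lemma digit_structured_card_5:
  assumes hp: "hadamard_pair R B L" and card: "card B = 5"
  shows "\<exists>S. digit_structured R 5 S B L"
proof -
  have fin: "finite B" and R: "0 < R" "R \<noteq> 0" and card': "card L = 5"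
    using hp card by (auto simp: hadamard_pair_iff)
  define T5 where "T5 D \<longleftrightarrow> (\<forall>b\<in>B. \<forall>b'\<in>B. b \<noteq> b' \<longrightarrow>
    unity_root R (b * D) ^ 5 = unity_root R (b' * D) ^ 5 \<and> unity_root R (b * D) \<noteq> unity_root R (b' * D))" for D
  define T23 where "T23 D \<longleftrightarrow> two_three_split B (\<lambda>b. unity_root R (b * D))" for D
  have type: "T5 (l - l') \<or> T23 (l - l')" if "l \<in> L" "l' \<in> L" "l \<noteq> l'" for l l'
    unfolding T5_def T23_def
    by (rule five_roots_of_unity_sum_zero[OF fin card R(1)]) (use hp that in \<open>simp add: hadamard_pair_iff\<close>)
  have val2: "multiplicity 2 D = multiplicity 2 D'" if "T23 D" "T23 D'" "D \<noteq> 0" "D' \<noteq> 0" for D D'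
    using two_three_split_valuation_not_less[of R D D' B] two_three_split_valuation_not_less[of R D' D B]
      that R fin card by (simp add: T23_def)
  have val5: "multiplicity 5 D' < multiplicity 5 D" if "T23 D" "T5 D'" "D \<noteq> 0" "D' \<noteq> 0" for D D'
    using two_three_split_valuation_5[OF R(2) that(3,4) card] that(1,2) unfolding T23_def T5_def by blast
  have not_T23: "\<not> T23 (D - D')" if "T5 D" "T5 D'" "D \<noteq> D'" for D D'
  proof
    assume "T23 (D - D')"
    then have split: "two_three_split B (\<lambda>b. unity_root R (b * (D - D')))" by (simp add: T23_def)
    have "D - D' \<noteq> 0" using that(3) by simp
    obtain P where P: "P \<subseteq> B" "card P = 2"
      "\<And>b b'. b \<in> P \<Longrightarrow> b' \<in> P \<Longrightarrow> b \<noteq> b' \<Longrightarrow> R dvd 2 * ((b - b') * (D - D'))"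
      "\<And>b b'. b \<in> P \<Longrightarrow> b' \<in> P \<Longrightarrow> b \<noteq> b' \<Longrightarrow> \<not> R dvd (b - b') * (D - D')"
      "\<And>b b'. b \<in> B - P \<Longrightarrow> b' \<in> B - P \<Longrightarrow> b \<noteq> b' \<Longrightarrow> R dvd 3 * ((b - b') * (D - D'))"
      using two_three_split_valuations[OF R(2) \<open>D - D' \<noteq> 0\<close> split] by blast
    obtain x y where xy: "P = {x, y}" "x \<noteq> y" using P(2) by (auto simp: card_2_iff)
    have "R dvd 5 * ((x - y) * E)" if "T5 E" for E
    proof -
      have "unity_root R (x * E) ^ 5 = unity_root R (y * E) ^ 5" using that xy P(1) by (auto simp: T5_def)
      then show ?thesis using R(2) by (simp add: unity_root_power unity_root_eq_iff algebra_simps)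
    qed
    then have "R dvd 5 * ((x - y) * D) - 5 * ((x - y) * D')" using that(1,2) by (intro dvd_diff) auto
    \<comment> \<open>\<open>R\<close> divides 5 times \<open>(x - y) * (D - D')\<close> by the
      fifth roots and 4 times it by the antipodal pair, hence the product itself; but then the
      antipodal numbers would be equal.\<close>
    moreover have "R dvd 2 * (2 * ((x - y) * (D - D')))" by (rule dvd_mult) (use P(3)[of x y] xy in blast)
    ultimately have "R dvd (5 * ((x - y) * D) - 5 * ((x - y) * D')) - 2 * (2 * ((x - y) * (D - D')))"
      by (rule dvd_diff)
    then have "R dvd (x - y) * (D - D')" by (simp add: algebra_simps)
    then show False using P(4)[of x y] xy by simp
  qed
  have all_T5: "T5 (l - l')" if l: "l \<in> L" "l' \<in> L" "l \<noteq> l'" for l l'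
  proof (rule ccontr)
    assume "\<not> T5 (l - l')"
    then have T: "T23 (l - l')" using type[OF l] by simp
    have "\<not> L \<subseteq> {l, l'}" using card_mono[of "{l, l'}" L] card' l by (auto simp: card_insert_if)
    then obtain m where m: "m \<in> L" "l \<noteq> m" "l' \<noteq> m" by blast
    have sum: "l - m = (l - l') + (l' - m)" "l' - m = (l' - l) + (l - m)" by simp_all
    consider "T5 (l - m)" "T5 (l' - m)" | "T5 (l - m)" "T23 (l' - m)" | "T23 (l - m)" "T5 (l' - m)"
      | "T23 (l - m)" "T23 (l' - m)"
      using type[OF l(1) m(1,2)] type[OF l(2) m(1,3)] by blast
    then show False
    proof cases
      case 1
      then show False using not_T23[of "l - m" "l' - m"] T l by simp
    next
      case 2
      have "multiplicity 5 (l - m) < multiplicity 5 (l - l')" "multiplicity 5 (l - m) < multiplicity 5 (l' - m)"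
        using val5 2 T l m by simp_all
      then show False
        using multiplicity_add_ge[of 5 "l - l'" "l' - m" "Suc (multiplicity 5 (l - m))"] m by simp
    next
      case 3
      have "multiplicity 5 (l' - m) < multiplicity 5 (l' - l)" "multiplicity 5 (l' - m) < multiplicity 5 (l - m)"
        using val5 3 T l m by (simp_all add: multiplicity_diff_commute[of 5 l' l])
      then show False
        using multiplicity_add_ge[of 5 "l' - l" "l - m" "Suc (multiplicity 5 (l' - m))"] m by simp
    next
      case 4
      then show False
        using multiplicity_2_add[of "l - l'" "l' - m"] val2[OF T 4(1)] val2[OF T 4(2)] l m by simp
    qed
  qed
  show ?thesis
  proof (rule digit_structured_prime_size[OF hp])
    fix b b' l l' assume "b \<in> B" "b' \<in> B" "b \<noteq> b'" "l \<in> L" "l' \<in> L" "l \<noteq> l'"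
    then show "unity_root R (b * (l - l')) ^ nat 5 = unity_root R (b' * (l - l')) ^ nat 5 \<and>
        unity_root R (b * (l - l')) \<noteq> unity_root R (b' * (l - l'))"
      using all_T5[of l l'] unfolding T5_def by (simp only: nat_numeral) blast
  qed (use card in simp_all)
qed

section \<open>Complements given by digit sets\<close>

text \<open>Mixed radix numbers with digits at the positions \<open>i \<in> A\<close> (weight \<open>p ^ i\<close>, radix \<open>p\<close>) and one leading
  digit at position \<open>\<rho>\<close> (weight \<open>p ^ \<rho>\<close>, radix \<open>M\<close>).\<close>

definition radix :: "int \<Rightarrow> nat \<Rightarrow> int \<Rightarrow> nat \<Rightarrow> int" where
  "radix p \<rho> M i = (if i = \<rho> then M else p)"

definition digit_value :: "int \<Rightarrow> nat \<Rightarrow> nat set \<Rightarrow> (nat \<Rightarrow> int) \<Rightarrow> int" where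
  "digit_value p \<rho> A g = (\<Sum>i\<in>insert \<rho> A. g i * p ^ i)"

definition digit_vectors :: "int \<Rightarrow> nat \<Rightarrow> int \<Rightarrow> nat set \<Rightarrow> (nat \<Rightarrow> int) set" where
  "digit_vectors p \<rho> M A = (PiE (insert \<rho> A) (\<lambda>i. {0..<radix p \<rho> M i}))"

definition digit_set :: "int \<Rightarrow> nat \<Rightarrow> int \<Rightarrow> nat set \<Rightarrow> int set" where
  "digit_set p \<rho> M A = digit_value p \<rho> A ` digit_vectors p \<rho> M A"

text \<open>The lowest position with different digits decides. Below \<open>\<rho>\<close> it is the
  valuation, because the digits differ there by less than the prime \<open>p\<close>; at
  \<open>\<rho>\<close> only the leading digits differ, by less than \<open>M\<close>.\<close>

lemma digit_value_diff:
  assumes p: "prime p" and A: "A \<subseteq> {..<\<rho>}"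
    and g: "g \<in> digit_vectors p \<rho> M A" and h: "h \<in> digit_vectors p \<rho> M A" and ne: "g \<noteq> h"
  defines "d \<equiv> digit_value p \<rho> A g - digit_value p \<rho> A h"
  shows "d \<noteq> 0 \<and> (multiplicity p d \<in> A \<or> p ^ \<rho> dvd d \<and> \<bar>d\<bar> < p ^ \<rho> * M)"
proof -
  let ?I = "insert \<rho> A"
  have finI: "finite ?I" using A finite_subset by auto
  have p0: "0 < p" using p by (rule prime_gt_0_int)
  define e where "e i = g i - h i" for i
  have d: "d = (\<Sum>i\<in>?I. e i * p ^ i)"
    by (simp add: d_def digit_value_def e_def left_diff_distrib flip: sum_subtractf)
  define J where "J = {i \<in> ?I. e i \<noteq> 0}"
  have J: "finite J" "J \<noteq> {}"
  proof -
    have "\<exists>i\<in>?I. g i \<noteq> h i"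
    proof (rule ccontr)
      assume "\<not> (\<exists>i\<in>?I. g i \<noteq> h i)"
      then have "g = h" using g h unfolding digit_vectors_def by (intro PiE_ext) auto
      with ne show False ..
    qed
    then show "J \<noteq> {}" by (auto simp: J_def e_def)
  qed (use finI in \<open>simp add: J_def\<close>)
  define m where "m = Min J"
  have mJ: "m \<in> J" and least: "\<And>i. i \<in> ?I \<Longrightarrow> i < m \<Longrightarrow> e i = 0"
    using J Min_in[OF J] Min_le[OF J(1)] unfolding m_def by (auto simp: J_def not_less[symmetric])
  then have m: "m \<in> ?I" "e m \<noteq> 0" by (auto simp: J_def)
  have bound: "\<bar>e i\<bar> < radix p \<rho> M i" if "i \<in> ?I" for i
  proof -
    have "g i \<in> {0..<radix p \<rho> M i}" "h i \<in> {0..<radix p \<rho> M i}"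
      using g h that by (auto simp: digit_vectors_def PiE_iff)
    then show ?thesis by (auto simp: e_def)
  qed
  have dm: "d = e m * p ^ m + (\<Sum>i\<in>?I - {m}. e i * p ^ i)"
    unfolding d by (rule sum.remove[OF finI m(1)])
  have rest: "p ^ Suc m dvd (\<Sum>i\<in>?I - {m}. e i * p ^ i)"
  proof (rule dvd_sum)
    fix i assume i: "i \<in> ?I - {m}"
    show "p ^ Suc m dvd e i * p ^ i"
    proof (cases "i < m")
      case True
      then show ?thesis using least i by simp
    next
      case False
      then have "Suc m \<le> i" using i by auto
      then show ?thesis by (intro dvd_mult le_imp_power_dvd)
    qed
  qed
  show ?thesis
  proof (cases "m = \<rho>")
    case True
    have "(\<Sum>i\<in>?I - {m}. e i * p ^ i) = 0"
      using least A True by (intro sum.neutral) auto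
    then have "d = e \<rho> * p ^ \<rho>" using dm True by simp
    moreover have "\<bar>e \<rho>\<bar> < M" using bound[of \<rho>] by (simp add: radix_def)
    ultimately show ?thesis using m(2) True p0 by (simp add: abs_mult mult.commute)
  next
    case False
    then have mA: "m \<in> A" using m(1) by simp
    have "\<bar>e m\<bar> < p" using bound[OF m(1)] False by (simp add: radix_def)
    then have "\<not> p dvd e m" using m(2) by (metis dvd_imp_le_int leD abs_of_pos p0)
    then have ndvd: "\<not> p ^ Suc m dvd e m * p ^ m" using p0 by (simp add: mult.commute)
    have "\<not> p ^ Suc m dvd d"
    proof
      assume "p ^ Suc m dvd d"
      then have "p ^ Suc m dvd e m * p ^ m" using rest by (simp only: dm dvd_add_left_iff)
      with ndvd show False ..
    qed
    moreover have "p ^ m dvd d"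
      unfolding dm using rest by (intro dvd_add) (auto intro: dvd_trans[OF le_imp_power_dvd])
    ultimately have "multiplicity p d = m" by (intro multiplicity_eqI)
    then show ?thesis using mA \<open>\<not> p ^ Suc m dvd d\<close> by auto
  qed
qed

lemma digit_set_facts:
  assumes p: "prime p" and A: "A \<subseteq> {..<\<rho>}" and M: "0 < M"
  shows digit_value_inj: "inj_on (digit_value p \<rho> A) (digit_vectors p \<rho> M A)"
    and finite_digit_set: "finite (digit_set p \<rho> M A)"
    and card_digit_set: "card (digit_set p \<rho> M A) = nat p ^ card A * nat M"
    and zero_in_digit_set: "0 \<in> digit_set p \<rho> M A"
    and weight_in_digit_set: "i \<in> A \<Longrightarrow> p ^ i \<in> digit_set p \<rho> M A"
    and top_weight_in_digit_set: "2 \<le> M \<Longrightarrow> p ^ \<rho> \<in> digit_set p \<rho> M A"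
proof -
  have finA: "finite A" "\<rho> \<notin> A" using A finite_subset by auto
  have p2: "2 \<le> p" using p by (rule prime_ge_2_int)
  show inj: "inj_on (digit_value p \<rho> A) (digit_vectors p \<rho> M A)"
    using digit_value_diff[OF p A] by (intro inj_onI) (metis diff_self)
  have "finite (digit_vectors p \<rho> M A)"
    unfolding digit_vectors_def using finA by (intro finite_PiE) auto
  then show "finite (digit_set p \<rho> M A)" by (simp add: digit_set_def)
  have "card (digit_vectors p \<rho> M A) = (\<Prod>i\<in>insert \<rho> A. nat (radix p \<rho> M i))"
    unfolding digit_vectors_def using finA by (subst card_PiE) auto
  also have "\<dots> = nat M * (\<Prod>i\<in>A. nat (radix p \<rho> M i))"
    using finA by (subst prod.insert) (simp_all add: radix_def)
  also have "(\<Prod>i\<in>A. nat (radix p \<rho> M i)) = (\<Prod>i\<in>A. nat p)"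
    using finA by (intro prod.cong refl) (auto simp: radix_def)
  finally show "card (digit_set p \<rho> M A) = nat p ^ card A * nat M"
    unfolding digit_set_def by (simp add: card_image[OF inj])
  have vec: "(\<lambda>j\<in>insert \<rho> A. if j = i then c else 0) \<in> digit_vectors p \<rho> M A"
    if "0 \<le> c" "c < radix p \<rho> M i" for i c
    unfolding digit_vectors_def using that p2 M by (auto simp: radix_def)
  have val: "digit_value p \<rho> A (\<lambda>j\<in>insert \<rho> A. if j = i then c else 0) = c * p ^ i" if "i \<in> insert \<rho> A" for i c
  proof -
    have "digit_value p \<rho> A (\<lambda>j\<in>insert \<rho> A. if j = i then c else 0) = (\<Sum>j\<in>insert \<rho> A. if j = i then c * p ^ i else 0)"
      unfolding digit_value_def by (intro sum.cong) auto
    then show ?thesis using that finA by (simp add: sum.delta)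
  qed
  have mem: "c * p ^ i \<in> digit_set p \<rho> M A" if "0 \<le> c" "c < radix p \<rho> M i" "i \<in> insert \<rho> A" for i c
    unfolding digit_set_def using val[OF that(3), of c] vec[OF that(1,2)] by (metis image_eqI)
  show "0 \<in> digit_set p \<rho> M A" using mem[of 0 \<rho>] M by (simp add: radix_def)
  show "p ^ i \<in> digit_set p \<rho> M A" if "i \<in> A"
  proof -
    have "i \<noteq> \<rho>" using that finA(2) by auto
    then show ?thesis using mem[of 1 i] that p2 by (simp add: radix_def)
  qed
  show "p ^ \<rho> \<in> digit_set p \<rho> M A" if "2 \<le> M" using mem[of 1 \<rho>] that by (simp add: radix_def)
qed

lemma digit_set_diff:
  assumes "prime p" "A \<subseteq> {..<\<rho>}" "x \<in> digit_set p \<rho> M A" "y \<in> digit_set p \<rho> M A" "x \<noteq> y"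
  shows "multiplicity p (x - y) \<in> A \<or> p ^ \<rho> dvd x - y \<and> \<bar>x - y\<bar> < p ^ \<rho> * M"
proof -
  obtain g h where "g \<in> digit_vectors p \<rho> M A" "x = digit_value p \<rho> A g"
      "h \<in> digit_vectors p \<rho> M A" "y = digit_value p \<rho> A h"
    using assms(3,4) by (auto simp: digit_set_def)
  then show ?thesis using digit_value_diff[OF assms(1,2), of g M h] assms(5) by auto
qed

section \<open>Character sums over digit sets\<close>

lemma unity_root_sum: "finite I \<Longrightarrow> unity_root n (\<Sum>i\<in>I. f i) = (\<Prod>i\<in>I. unity_root n (f i))"
  by (induction I rule: finite_induct) (simp_all add: unity_root_add)

lemma sum_unity_root_residues_int:
  assumes "0 < n" "\<not> n dvd m"
  shows "(\<Sum>k\<in>{0..<n}. unity_root n (k * m)) = 0"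
proof -
  have "(\<Sum>k\<in>{0..<n}. unity_root n (k * m)) = (\<Sum>k<nat n. unity_root n (int k * m))"
    using assms(1) by (intro sum.reindex_bij_witness[of _ int nat]) auto
  also have "\<dots> = 0" using sum_unity_root_residues[of "nat n" m] assms by simp
  finally show ?thesis .
qed

text \<open>The sum factors into one geometric sum per position. If \<open>M\<close> does not divide
  \<open>l\<close>, the factor of the leading digit vanishes; otherwise the factor at position
  \<open>\<rho> - 1 - v\<close> does, with \<open>v\<close> the valuation of \<open>l\<close>,
  because the digit there multiplies the exponent of a primitive \<open>p\<close>-th root of
  unity.\<close>

lemma digit_set_sum_zero:
  assumes p: "prime p" and A: "A \<subseteq> {..<\<rho>}" and M: "0 < M" "\<not> p dvd M"
    and l: "l \<noteq> 0" "\<not> p ^ \<rho> * M dvd l"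
    and val: "multiplicity p l < \<rho> \<Longrightarrow> \<rho> - 1 - multiplicity p l \<in> A"
  shows "(\<Sum>x\<in>digit_set p \<rho> M A. unity_root (p ^ \<rho> * M) (x * l)) = 0"
proof -
  let ?I = "insert \<rho> A" and ?R = "p ^ \<rho> * M"
  have p0: "0 < p" using p by (rule prime_gt_0_int)
  have pu: "\<not> is_unit p" using p not_prime_unit by blast
  have finI: "finite ?I" using A finite_subset by auto
  have "(\<Sum>x\<in>digit_set p \<rho> M A. unity_root ?R (x * l)) =
      (\<Sum>g\<in>digit_vectors p \<rho> M A. unity_root ?R (digit_value p \<rho> A g * l))"
    unfolding digit_set_def by (subst sum.reindex[OF digit_value_inj[OF p A M(1)]]) simp
  also have "\<dots> = (\<Sum>g\<in>digit_vectors p \<rho> M A. \<Prod>i\<in>?I. unity_root ?R (g i * (p ^ i * l)))"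
    unfolding digit_value_def by (simp only: sum_distrib_right unity_root_sum[OF finI] mult.assoc)
  also have "\<dots> = (\<Prod>i\<in>?I. \<Sum>k\<in>{0..<radix p \<rho> M i}. unity_root ?R (k * (p ^ i * l)))"
    unfolding digit_vectors_def by (subst prod_sum_PiE) (use finI in auto)
  also have "\<dots> = 0"
  proof (cases "M dvd l")
    case False
    have "unity_root ?R (k * (p ^ \<rho> * l)) = unity_root M (k * l)" for k
      using unity_root_scale[of "p ^ \<rho>" M "k * l"] p0 by (simp add: mult.left_commute)
    then have "(\<Sum>k\<in>{0..<radix p \<rho> M \<rho>}. unity_root ?R (k * (p ^ \<rho> * l))) = 0"
      using sum_unity_root_residues_int[OF M(1) False] by (simp add: radix_def)
    then show ?thesis using finI by (intro prod_zero) blast+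
  next
    case True
    then obtain l1 where l1: "l = M * l1" by (auto elim: dvdE)
    define v where "v = multiplicity p l"
    have "multiplicity p l1 = v"
      unfolding v_def l1 by (rule multiplicity_prime_elem_times_other[OF prime_imp_prime_elem[OF p] M(2), symmetric])
    then obtain l2 where l2: "l1 = p ^ v * l2" "\<not> p dvd l2"
      using multiplicity_decompose'[of l1 p] l l1 pu by auto
    have v: "v < \<rho>"
    proof (rule ccontr)
      assume "\<not> v < \<rho>"
      then have "p ^ \<rho> dvd l1" unfolding l2(1) by (intro dvd_mult2 le_imp_power_dvd) simp
      then show False using l(2) l1 by (simp add: mult.commute)
    qed
    define i where "i = \<rho> - 1 - v"
    have i: "i \<in> A" "i + v = \<rho> - 1" "i \<noteq> \<rho>" using val v by (auto simp: v_def i_def)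
    have \<rho>: "p ^ \<rho> = p ^ (i + v) * p" using v i(2) by (metis Suc_diff_1 gr_zeroI not_less_zero power_Suc2)
    have "unity_root ?R (k * (p ^ i * l)) = unity_root p (k * l2)" for k
    proof -
      have "?R = (M * p ^ (i + v)) * p" "k * (p ^ i * l) = (M * p ^ (i + v)) * (k * l2)"
        unfolding \<rho> l1 l2(1) by (simp_all add: power_add mult_ac)
      then show ?thesis using M p0 by (simp only:) (intro unity_root_scale, simp)
    qed
    then have "(\<Sum>k\<in>{0..<radix p \<rho> M i}. unity_root ?R (k * (p ^ i * l))) = 0"
      using sum_unity_root_residues_int[OF p0 l2(2)] i(3) by (simp add: radix_def)
    then show ?thesis using finI i(1) by (intro prod_zero) blast+
  qed
  finally show ?thesis .
qed

lemma hadamard_pair_digit_sets: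
  assumes p: "prime p" and A: "A \<subseteq> {..<\<rho>}" and M: "0 < M" "\<not> p dvd M" and R: "2 \<le> p ^ \<rho> * M"
  shows "hadamard_pair (p ^ \<rho> * M) (digit_set p \<rho> M A) (digit_set p \<rho> M ((\<lambda>i. \<rho> - 1 - i) ` A))"
proof -
  let ?A' = "(\<lambda>i. \<rho> - 1 - i) ` A"
  have p0: "0 < p" using p by (rule prime_gt_0_int)
  have A': "?A' \<subseteq> {..<\<rho>}" using A by auto
  have inj: "inj_on (\<lambda>i. \<rho> - 1 - i) A"
  proof (rule inj_onI)
    fix i j assume "i \<in> A" "j \<in> A" "\<rho> - 1 - i = \<rho> - 1 - j"
    moreover from this have "i < \<rho>" "j < \<rho>" using A by auto
    ultimately show "i = j" by linarith
  qed
  \<comment> \<open>Stated for two position sets, so that both orthogonality relations follow by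
    exchanging a set with its mirror image.\<close>
  have zero: "(\<Sum>x\<in>digit_set p \<rho> M C. unity_root (p ^ \<rho> * M) (x * (y - z))) = 0"
    if C: "C \<subseteq> {..<\<rho>}" "C' \<subseteq> {..<\<rho>}" "\<And>i. i \<in> C' \<Longrightarrow> \<rho> - 1 - i \<in> C"
      and y: "y \<in> digit_set p \<rho> M C'" "z \<in> digit_set p \<rho> M C'" "y \<noteq> z" for C C' y z
  proof (rule digit_set_sum_zero[OF p C(1) M])
    show "\<not> p ^ \<rho> * M dvd y - z"
    proof
      assume dvd: "p ^ \<rho> * M dvd y - z"
      then have "p ^ \<rho> * M \<le> \<bar>y - z\<bar>" using dvd_imp_le_int[OF _ dvd] y(3) p0 M(1) by (simp add: abs_mult)
      then have "multiplicity p (y - z) \<in> C'" using digit_set_diff[OF p C(2) y] by auto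
      moreover have "p ^ \<rho> dvd y - z" using dvd by (rule dvd_mult_left)
      then have "\<rho> \<le> multiplicity p (y - z)" using y(3) p by (intro multiplicity_geI) auto
      ultimately show False using C(2) by auto
    qed
    assume less: "multiplicity p (y - z) < \<rho>"
    have "\<not> p ^ \<rho> dvd y - z"
    proof
      assume "p ^ \<rho> dvd y - z"
      then have "\<rho> \<le> multiplicity p (y - z)" using y(3) p by (intro multiplicity_geI) auto
      then show False using less by simp
    qed
    then have "multiplicity p (y - z) \<in> C'" using digit_set_diff[OF p C(2) y] by auto
    then show "\<rho> - 1 - multiplicity p (y - z) \<in> C" by (rule C(3))
  qed (use y in simp)
  show ?thesis
    unfolding hadamard_pair_iff
  proof (intro conjI ballI impI)
    show "card (digit_set p \<rho> M A) = card (digit_set p \<rho> M ?A')"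
      unfolding card_digit_set[OF p A M(1)] card_digit_set[OF p A' M(1)] card_image[OF inj] by (rule refl)
  next
    fix b b' assume *: "b \<in> digit_set p \<rho> M A" "b' \<in> digit_set p \<rho> M A" "b \<noteq> b'"
    show "(\<Sum>l\<in>digit_set p \<rho> M ?A'. unity_root (p ^ \<rho> * M) ((b - b') * l)) = 0"
      using zero[OF A' A _ *] by (simp add: mult.commute)
  next
    fix l l' assume *: "l \<in> digit_set p \<rho> M ?A'" "l' \<in> digit_set p \<rho> M ?A'" "l \<noteq> l'"
    show "(\<Sum>b\<in>digit_set p \<rho> M A. unity_root (p ^ \<rho> * M) (b * (l - l'))) = 0"
      using A by (intro zero[OF A A' _ *]) auto
  qed (use R finite_digit_set[OF p A M(1)] finite_digit_set[OF p A' M(1)]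
      zero_in_digit_set[OF p A M(1)] zero_in_digit_set[OF p A' M(1)] in blast)+
qed

section \<open>Extreme cycles and greatest common divisors\<close>

lemma complete_representatives_sumsetI:
  assumes R: "0 < R" and fin: "finite B" "finite B'" and card: "int (card B * card B') = R"
    and inj: "\<And>b1 b2 c1 c2. b1 \<in> B \<Longrightarrow> b2 \<in> B \<Longrightarrow> c1 \<in> B' \<Longrightarrow> c2 \<in> B' \<Longrightarrow>
      R dvd (b1 + c1) - (b2 + c2) \<Longrightarrow> b1 = b2 \<and> c1 = c2"
  shows "complete_representatives R (sumset B B')"
proof -
  define f where "f = (\<lambda>(b, c). (b + c) mod R)"
  have inj_f: "inj_on f (B \<times> B')"
    using inj by (auto simp: inj_on_def f_def mod_eq_dvd_iff)
  have "f ` (B \<times> B') = {0..<R}"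
  proof (rule card_subset_eq)
    show "f ` (B \<times> B') \<subseteq> {0..<R}" using R by (auto simp: f_def)
    show "card (f ` (B \<times> B')) = card {0..<R}"
      using card by (simp add: card_image[OF inj_f] card_cartesian_product nat_eq_iff2 flip: of_nat_mult)
  qed simp
  then have surj: "\<exists>b\<in>B. \<exists>c\<in>B'. (b + c) mod R = n mod R" for n
  proof -
    have "n mod R \<in> f ` (B \<times> B')" using R by (simp add: \<open>f ` (B \<times> B') = {0..<R}\<close>)
    then obtain b c where "b \<in> B" "c \<in> B'" "(b + c) mod R = n mod R" by (auto simp: f_def)
    then show ?thesis by blast
  qed
  show ?thesis
    unfolding complete_representatives_def
  proof (intro allI ex_ex1I)
    fix n
    show "\<exists>s. s \<in> sumset B B' \<and> [s = n] (mod R)"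
      using surj[of n] by (auto simp: sumset_def cong_def)
  next
    fix n s s' assume "s \<in> sumset B B' \<and> [s = n] (mod R)" "s' \<in> sumset B B' \<and> [s' = n] (mod R)"
    then show "s = s'"
      using inj by (auto simp: sumset_def cong_def mod_eq_dvd_iff[symmetric]) (metis mod_eq_dvd_iff)
  qed
qed

text \<open>If a nonzero difference in \<open>B\<close> agrees modulo \<open>p ^ \<rho>\<close> with
  one in \<open>B'\<close>, both have the same valuation below \<open>\<rho>\<close>, which would
  lie in \<open>S\<close> and outside it. Equal differences thus give disjointness, congruent ones
  distinct residues; when only the \<open>B'\<close> parts differ, the bound
  \<open>p ^ \<rho> * M\<close> excludes a congruence.\<close>

lemma digit_complement:
  assumes p: "prime p" and M: "0 < M" and S: "S \<subseteq> {..<\<rho>}"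
    and B: "finite B" "0 \<in> B" "card B = nat p ^ card S" "valuations p B \<subseteq> S"
  defines "B' \<equiv> digit_set p \<rho> M ({..<\<rho>} - S)"
  shows "disjoint_differences B B'" "complete_representatives (p ^ \<rho> * M) (sumset B B')"
proof -
  have A: "{..<\<rho>} - S \<subseteq> {..<\<rho>}" by simp
  have p0: "0 < p" using p by (rule prime_gt_0_int)
  have eq: "b1 = b2" if b: "b1 \<in> B" "b2 \<in> B" and c: "c1 \<in> B'" "c2 \<in> B'" and dvd: "p ^ \<rho> dvd (b1 - b2) - (c2 - c1)"
    for b1 b2 c1 c2
  proof (rule ccontr)
    assume ne: "b1 \<noteq> b2"
    define s where "s = multiplicity p (b1 - b2)"
    have s: "s \<in> S" using B(4) b ne by (auto simp: valuations_def s_def)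
    then have "s < \<rho>" using S by auto
    then have dvd': "p ^ Suc s dvd (b1 - b2) - (c2 - c1)"
      by (intro dvd_trans[OF le_imp_power_dvd dvd]) simp
    have sx: "p ^ s dvd b1 - b2" unfolding s_def by (rule multiplicity_dvd)
    have nsx: "\<not> p ^ Suc s dvd b1 - b2"
    proof
      assume "p ^ Suc s dvd b1 - b2"
      then have "Suc s \<le> multiplicity p (b1 - b2)" using ne p by (intro multiplicity_geI) auto
      then show False by (simp add: s_def)
    qed
    have "p ^ s dvd (b1 - b2) - (c2 - c1)" using dvd' by (rule dvd_trans[rotated]) (simp add: le_imp_power_dvd)
    from dvd_diff[OF sx this] have sy: "p ^ s dvd c2 - c1" by simp
    have nsy: "\<not> p ^ Suc s dvd c2 - c1"
    proof
      assume "p ^ Suc s dvd c2 - c1"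
      from dvd_add[OF dvd' this] show False using nsx by simp
    qed
    have "multiplicity p (c2 - c1) = s" using sy nsy by (rule multiplicity_eqI)
    moreover have "c2 \<noteq> c1" using nsy by auto
    moreover have "\<not> p ^ \<rho> dvd c2 - c1"
      using nsy \<open>s < \<rho>\<close> by (metis dvd_trans le_imp_power_dvd Suc_leI)
    ultimately have "s \<in> {..<\<rho>} - S" using digit_set_diff[OF p A, of c2 M c1] c by (simp add: B'_def)
    then show False using s by simp
  qed
  have "0 \<in> B'" unfolding B'_def by (rule zero_in_digit_set[OF p A M])
  have "d = 0" if d: "d \<in> {a - b | a b. a \<in> B \<and> b \<in> B}" "d \<in> {a - b | a b. a \<in> B' \<and> b \<in> B'}" for d
  proof -
    obtain b1 b2 c1 c2 where "d = b1 - b2" "b1 \<in> B" "b2 \<in> B" "d = c2 - c1" "c2 \<in> B'" "c1 \<in> B'"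
      using d by blast
    then show ?thesis using eq[of b1 b2 c1 c2] by simp
  qed
  moreover have "0 \<in> {a - b | a b. a \<in> B \<and> b \<in> B}" "0 \<in> {a - b | a b. a \<in> B' \<and> b \<in> B'}"
    using B(2) \<open>0 \<in> B'\<close> by force+
  ultimately show "disjoint_differences B B'" unfolding disjoint_differences_def by blast
  show "complete_representatives (p ^ \<rho> * M) (sumset B B')"
  proof (rule complete_representatives_sumsetI)
    show "0 < p ^ \<rho> * M" using p0 M by simp
    show "finite B'" unfolding B'_def by (rule finite_digit_set[OF p A M])
    have "card S + card ({..<\<rho>} - S) = \<rho>"
      using S card_mono[OF _ S] by (simp add: card_Diff_subset finite_subset)
    then have "nat p ^ card S * nat p ^ card ({..<\<rho>} - S) = nat p ^ \<rho>" by (metis power_add)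
    then have "card B * card B' = nat p ^ \<rho> * nat M"
      unfolding B'_def card_digit_set[OF p A M] B(3) by (simp add: mult.assoc[symmetric])
    then show "int (card B * card B') = p ^ \<rho> * M" using p0 M by simp
  next
    fix b1 b2 c1 c2
    assume *: "b1 \<in> B" "b2 \<in> B" "c1 \<in> B'" "c2 \<in> B'" and dvd: "p ^ \<rho> * M dvd (b1 + c1) - (b2 + c2)"
    have "p ^ \<rho> dvd (b1 - b2) - (c2 - c1)" using dvd_mult_left[OF dvd] by (simp add: algebra_simps)
    then have b: "b1 = b2" using eq * by blast
    then have dvd2: "p ^ \<rho> * M dvd c1 - c2" using dvd by simp
    have "c1 = c2"
    proof (rule ccontr)
      assume ne: "c1 \<noteq> c2"
      have "p ^ \<rho> * M \<le> \<bar>c1 - c2\<bar>" using dvd_imp_le_int[OF _ dvd2] ne p0 M by (simp add: abs_mult)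
      moreover have "\<rho> \<le> multiplicity p (c1 - c2)"
        using dvd_mult_left[OF dvd2] ne p by (intro multiplicity_geI) auto
      ultimately show False
        using digit_set_diff[OF p A _ _ ne, of M] * by (auto simp: B'_def)
    qed
    with b show "b1 = b2 \<and> c1 = c2" ..
  qed (rule B)
qed

section \<open>Unimodular values of the mask and integrality of cycles\<close>

text \<open>Equality in the triangle inequality: after rotation by \<open>cnj u\<close> all terms
  have real part 1 and so equal 1, and the term of \<open>0 \<in> B\<close> shows that
  \<open>u\<close> itself is 1.\<close>

lemma unit_mask_integral:
  assumes B: "finite B" "0 \<in> B" "b \<in> B" and mask: "cmod (mask B x) = 1"
  shows "real_of_int b * x \<in> \<int>"
proof -
  define u where "u = mask B x"
  define z where "z b = cis (2 * pi * real_of_int b * x)" for b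
  have N: "real (card B) > 0" using B by (auto simp: card_gt_0_iff)
  have uu: "cnj u * u = 1" using mask by (simp add: u_def mult.commute flip: complex_norm_square)
  have sum: "(\<Sum>b\<in>B. cnj u * z b) = of_nat (card B)"
  proof -
    have "(\<Sum>b\<in>B. z b) = of_nat (card B) * u" using N by (simp add: u_def mask_def z_def)
    then have "(\<Sum>b\<in>B. cnj u * z b) = of_nat (card B) * (cnj u * u)" by (simp add: mult_ac flip: sum_distrib_left)
    then show ?thesis using uu by simp
  qed
  have norm: "cmod (cnj u * z b) = 1" for b using mask by (simp add: norm_mult u_def z_def)
  have "Re (\<Sum>b\<in>B. cnj u * z b) = real (card B)" by (simp add: sum)
  then have "(\<Sum>b\<in>B. 1 - Re (cnj u * z b)) = 0" by (simp add: sum_subtractf)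
  moreover have "0 \<le> 1 - Re (cnj u * z b)" for b
    using complex_Re_le_cmod[of "cnj u * z b"] by (simp only: norm)
  ultimately have "1 - Re (cnj u * z b) = 0" if "b \<in> B" for b
    using sum_nonneg_eq_0_iff[OF B(1), of "\<lambda>b. 1 - Re (cnj u * z b)"] that by blast
  then have Re: "Re (cnj u * z b) = 1" if "b \<in> B" for b using that by (metis eq_iff_diff_eq_0)
  have one: "cnj u * z b = 1" if "b \<in> B" for b
  proof -
    have "(Re (cnj u * z b))\<^sup>2 + (Im (cnj u * z b))\<^sup>2 = 1" using norm[of b] cmod_power2[of "cnj u * z b"] by simp
    then have "Im (cnj u * z b) = 0" by (simp only: Re[OF that]) simp
    then show ?thesis using Re[OF that] by (simp add: complex_eq_iff)
  qed
  have "z 0 = 1" by (simp add: z_def)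
  then have "cnj u = 1" using one[OF B(2)] by simp
  then have "z b = 1" using one[OF B(3)] by simp
  then have "cos (2 * pi * real_of_int b * x) = 1" by (simp add: z_def complex_eq_iff)
  then obtain k :: int where "2 * pi * real_of_int b * x = of_int k * 2 * pi" using cos_one_2pi_int by auto
  then have "real_of_int b * x = of_int k" by simp
  then show ?thesis by simp
qed

lemma integral_mask_unit:
  assumes "finite B" "B \<noteq> {}" "\<And>b. b \<in> B \<Longrightarrow> real_of_int b * x \<in> \<int>"
  shows "cmod (mask B x) = 1"
proof -
  have "cis (2 * pi * real_of_int b * x) = 1" if "b \<in> B" for b
    using cis_multiple_2pi[OF assms(3)[OF that]] by (simp add: mult.assoc)
  then have "(\<Sum>b\<in>B. cis (2 * pi * real_of_int b * x)) = of_nat (card B)" by simp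
  then show ?thesis using assms(1,2) by (simp add: mask_def)
qed

text \<open>Backwards, a point is \<open>R * x' - l\<close> for its successor \<open>x'\<close>, and
  \<open>R * x'\<close> is an integer multiple of the integer \<open>w * x'\<close>.\<close>

lemma cycle_integral:
  assumes cycle: "cycle R L C" and R: "R \<noteq> 0" and w: "w dvd R" "\<And>x. x \<in> C \<Longrightarrow> real_of_int w * x \<in> \<int>"
  shows "C \<subseteq> \<int>"
proof
  fix y assume "y \<in> C"
  obtain r x l where r: "0 < r" and C: "C = x ` {..<r}"
    and step: "\<And>k. k < r \<Longrightarrow> (x k + real_of_int (l k)) / real_of_int R = x (Suc k mod r)"
    using cycle by (auto simp: cycle_def)
  obtain k where k: "k < r" "y = x k" using \<open>y \<in> C\<close> C by auto
  obtain m where m: "R = w * m" using w(1) by (auto elim: dvdE)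
  let ?x' = "x (Suc k mod r)"
  have "?x' \<in> C" using r C by simp
  then have "real_of_int m * (real_of_int w * ?x') \<in> \<int>" by (rule Ints_mult[OF Ints_of_int w(2)])
  moreover have "x k = real_of_int m * (real_of_int w * ?x') - real_of_int (l k)"
    using step[OF k(1)] R by (simp add: m field_simps)
  ultimately show "y \<in> \<int>" using k(2) by simp
qed

text \<open>Going backwards multiplies absolute values by \<open>R\<close>, so the largest one in
  the finite cycle is 0.\<close>

lemma cycle_zero:
  assumes cycle: "cycle R {0} C" and R: "2 \<le> R"
  shows "C \<subseteq> \<int>"
proof -
  obtain r x l where r: "0 < r" and C: "C = x ` {..<r}"
    and step: "\<And>k. k < r \<Longrightarrow> l k \<in> {0} \<and> (x k + real_of_int (l k)) / real_of_int R = x (Suc k mod r)"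
    using cycle by (auto simp: cycle_def)
  have mul: "\<bar>x k\<bar> = real_of_int R * \<bar>x (Suc k mod r)\<bar>" if "k < r" for k
    using step[OF that] R by (auto simp: field_simps abs_mult)
  define m where "m = Max (abs ` C)"
  have fin: "finite (abs ` C)" "abs ` C \<noteq> {}" using C r by auto
  have le: "\<bar>y\<bar> \<le> m" if "y \<in> C" for y using that fin(1) by (simp add: m_def)
  have "m \<in> abs ` C" unfolding m_def using fin by (rule Max_in)
  then obtain k where k: "k < r" "m = \<bar>x k\<bar>" using C by auto
  define j where "j = (if k = 0 then r - 1 else k - 1)"
  have j: "j < r" "Suc j mod r = k" using k(1) by (auto simp: j_def)
  have "real_of_int R * m \<le> m" using mul[OF j(1)] le[of "x j"] j k C by auto
  moreover have "2 * m \<le> real_of_int R * m" using R k(2) by (intro mult_right_mono) auto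
  ultimately have "m \<le> 0" by simp
  then have "y = 0" if "y \<in> C" for y using le[OF that] by simp
  then show ?thesis by (metis Ints_0 subsetI)
qed

lemma sumset_zero_right [simp]: "sumset X {0} = X"
  by (simp add: sumset_def)

text \<open>If \<open>d = Gcd B\<close> were larger than 1, the map \<open>a \<mapsto> (a + l * d) / R\<close>, where \<open>l \<in> L\<close> is chosen so that
  the quotient is an integer, would carry 1 into a cycle of integers not divisible by \<open>d\<close>; divided by \<open>d\<close>,
  this is a nonintegral extreme cycle.\<close>

lemma Gcd_eq_1_of_complete:
  assumes R: "2 \<le> R" and fin: "finite B" "finite L"
    and B: "complete_representatives R B" and L: "complete_representatives R L"
    and ext: "\<And>C. extreme_cycle R B L C \<Longrightarrow> C \<subseteq> \<int>"
  shows "Gcd B = 1"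
proof (rule ccontr)
  define d where "d = Gcd B"
  assume "Gcd B \<noteq> 1"
  then have d1: "d \<noteq> 1" by (simp add: d_def)
  obtain b where b: "b \<in> B" "[b = 1] (mod R)" using B unfolding complete_representatives_def by blast
  have Rb: "R dvd b - 1" using b(2) by (simp add: cong_iff_dvd_diff)
  have db: "d dvd b" unfolding d_def using b(1) by (rule Gcd_dvd)
  have cop: "coprime d R"
  proof (rule coprimeI)
    fix c assume "c dvd d" "c dvd R"
    then have "c dvd b - (b - 1)" using db Rb by (meson dvd_diff dvd_trans)
    then show "is_unit c" by simp
  qed
  have d0: "0 \<le> d" by (simp add: d_def)
  have "d \<noteq> 0" using cop R by auto
  then have d2: "2 \<le> d" using d0 d1 by linarith
  have "\<exists>l\<in>L. R dvd a + d * l" for a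
  proof -
    obtain y where y: "[d * y = 1] (mod R)" using cop cong_solve_coprime_int by blast
    obtain l where l: "l \<in> L" "[l = y * (- a)] (mod R)" using L unfolding complete_representatives_def by blast
    have "[d * l = d * (y * (- a))] (mod R)" using l(2) by (rule cong_scalar_left)
    also have "d * (y * (- a)) = (d * y) * (- a)" by simp
    also have "[(d * y) * (- a) = 1 * (- a)] (mod R)" using y by (rule cong_scalar_right)
    finally have "R dvd d * l - (- a)" by (simp add: cong_iff_dvd_diff)
    then show ?thesis using l(1) by (auto simp: add.commute)
  qed
  then obtain lam where lam: "\<And>a. lam a \<in> L" "\<And>a. R dvd a + d * lam a" by metis
  define T where "T a = (a + d * lam a) div R" for a
  have T: "R * T a = a + d * lam a" for a using lam(2)[of a] by (simp add: T_def)
  define a where "a k = (T ^^ k) 1" for k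
  have a_Suc: "a (Suc k) = T (a k)" for k by (simp add: a_def)
  have not_dvd: "\<not> d dvd a k" for k
  proof (induction k)
    case 0
    then show ?case using d2 by (simp add: a_def)
  next
    case (Suc k)
    show ?case
    proof
      assume "d dvd a (Suc k)"
      then have "d dvd a k + d * lam (a k)" using T[of "a k"] by (metis a_Suc dvd_mult)
      then have "d dvd a k" by (simp only: dvd_add_left_iff dvd_triv_left)
      with Suc show False ..
    qed
  qed
  obtain K where K: "\<And>l. l \<in> L \<Longrightarrow> \<bar>l\<bar> \<le> K"
    using fin(2) by (metis Max_ge finite_imageI image_eqI)
  \<comment> \<open>The orbit starts at 1, and a term bounded by \<open>W\<close> has a successor
    bounded by \<open>(W + d * K) / 2\<close>, hence again by \<open>W\<close>.\<close>
  define W where "W = max 1 (d * K)"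
  have bound: "\<bar>a k\<bar> \<le> W" for k
  proof (induction k)
    case 0
    then show ?case by (simp add: a_def W_def)
  next
    case (Suc k)
    have "2 * \<bar>a (Suc k)\<bar> \<le> R * \<bar>a (Suc k)\<bar>" using R by (intro mult_right_mono) auto
    also have "\<dots> = \<bar>a k + d * lam (a k)\<bar>" using arg_cong[OF T[of "a k"], of abs] R by (simp add: a_Suc abs_mult)
    also have "\<dots> \<le> \<bar>a k\<bar> + d * \<bar>lam (a k)\<bar>" using abs_triangle_ineq[of "a k" "d * lam (a k)"] d0 by (simp add: abs_mult)
    also have "d * \<bar>lam (a k)\<bar> \<le> d * K" using K lam(1) d0 by (intro mult_left_mono) auto
    finally show ?case using Suc by (simp add: W_def)
  qed
  have "range a \<subseteq> {- W..W}" using bound by (auto simp: abs_le_iff minus_le_iff)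
  then have "finite (range a)" using finite_subset by blast
  then have "\<not> inj a" using finite_imageD infinite_UNIV_nat by blast
  \<comment> \<open>Boundedness forces a repetition; periodicity is claimed only from index
    \<open>i\<close> on, so the cycle starts there.\<close>
  then obtain i j where ij: "i < j" "a i = a j" by (metis injI linorder_neqE_nat)
  define r where "r = j - i"
  define x where "x k = real_of_int (a (i + k)) / real_of_int d" for k
  have step: "(x k + real_of_int (lam (a (i + k)))) / real_of_int R = x (Suc k mod r)" if k: "k < r" for k
  proof -
    have "a (i + (Suc k mod r)) = a (Suc (i + k))"
    proof (cases "Suc k = r")
      case True
      then have "Suc (i + k) = j" using ij(1) by (simp add: r_def)
      then show ?thesis using True ij(2) by simp
    qed (use k in simp)
    then have succ: "x (Suc k mod r) = real_of_int (T (a (i + k))) / real_of_int d" by (simp add: x_def a_Suc)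
    have "x k + real_of_int (lam (a (i + k))) = real_of_int (a (i + k) + d * lam (a (i + k))) / real_of_int d"
      using d2 by (simp add: x_def add_divide_distrib)
    also have "\<dots> = real_of_int R * x (Suc k mod r)" by (simp add: succ flip: T)
    finally show ?thesis using R by simp
  qed
  have "extreme_cycle R B L (x ` {..<r})"
    unfolding extreme_cycle_def
  proof (intro conjI ballI)
    show "cycle R L (x ` {..<r})"
      unfolding cycle_def using ij(1) step lam(1)
      by (intro exI[of _ r] exI[of _ x] exI[of _ "\<lambda>k. lam (a (i + k))"]) (simp add: r_def)
  next
    fix y assume "y \<in> x ` {..<r}"
    then obtain k where y: "y = x k" by auto
    show "cmod (mask B y) = 1"
    proof (rule integral_mask_unit[OF fin(1)])
      fix b' assume "b' \<in> B"
      then have "d dvd b'" unfolding d_def by (rule Gcd_dvd)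
      then obtain c where "b' = d * c" by (auto elim: dvdE)
      then have "real_of_int b' * y = of_int (c * a (i + k))" using d2 by (simp add: y x_def)
      then show "real_of_int b' * y \<in> \<int>" by (metis Ints_of_int)
    qed (use b in auto)
  qed
  then have "x ` {..<r} \<subseteq> \<int>" by (rule ext)
  moreover have "x 0 \<in> x ` {..<r}" using ij(1) by (simp add: r_def)
  ultimately obtain n where n: "x 0 = of_int n" by (auto elim: Ints_cases)
  then have "real_of_int (a i) = real_of_int (n * d)" using d2 by (simp add: x_def field_simps)
  then have "a i = n * d" by linarith
  then show False using not_dvd[of i] by simp
qed

section \<open>Assembly of the complementary pair\<close>

lemma complementary_of_digit_structured:
  assumes hp: "hadamard_pair R B L" and str: "digit_structured R p S B L"
    and ext: "\<And>C. extreme_cycle R B L C \<Longrightarrow> C \<subseteq> \<int>"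
  shows "\<exists>B' L'. hadamard_pair R B' L' \<and> complementary R B L B' L'"
proof -
  define \<rho> where "\<rho> = multiplicity p R"
  have R2: "2 \<le> R" and fin: "finite B" "finite L" and zero: "0 \<in> B" "0 \<in> L" and cards: "card B = card L"
    using hp by (auto simp: hadamard_pair_iff)
  have p: "prime p" and S: "S \<subseteq> {..<\<rho>}" and cB: "card B = nat p ^ card S"
    and vB: "valuations p B \<subseteq> S" and vL: "valuations p L \<subseteq> (\<lambda>s. \<rho> - 1 - s) ` S"
    using str by (auto simp: digit_structured_def \<rho>_def)
  have p0: "0 < p" using p by (rule prime_gt_0_int)
  obtain M where M: "R = p ^ \<rho> * M" "\<not> p dvd M"
    using multiplicity_decompose'[of R p] R2 p unfolding \<rho>_def by (metis not_numeral_le_zero not_prime_unit)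
  have M0: "0 < M" using M(1) R2 p0 by (smt (verit) mult_nonneg_nonpos zero_le_power)
  define A where "A = {..<\<rho>} - S"
  have A: "A \<subseteq> {..<\<rho>}" by (simp add: A_def)
  define S' where "S' = (\<lambda>s. \<rho> - 1 - s) ` S"
  have S': "S' \<subseteq> {..<\<rho>}" using S by (auto simp: S'_def)
  have inj: "inj_on (\<lambda>s. \<rho> - 1 - s) {..<\<rho>}" by (auto simp: inj_on_def)
  have cS': "card S' = card S" unfolding S'_def using inj_on_subset[OF inj S] by (rule card_image)
  \<comment> \<open>Reflection commutes with complementation, so \<open>L'\<close> is at once the
    mirror partner of \<open>B'\<close> and the digit complement of \<open>L\<close>.\<close>
  have A': "(\<lambda>i. \<rho> - 1 - i) ` A = {..<\<rho>} - S'"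
  proof -
    have "(\<lambda>i. \<rho> - 1 - i) ` {..<\<rho>} = {..<\<rho>}"
      by (rule endo_inj_surj[OF _ _ inj]) auto
    then show ?thesis unfolding A_def S'_def using inj_on_image_set_diff[OF inj, of "{..<\<rho>}" S] S by auto
  qed
  define B' where "B' = digit_set p \<rho> M A"
  define L' where "L' = digit_set p \<rho> M ({..<\<rho>} - S')"
  have hp': "hadamard_pair R B' L'"
    unfolding M(1) B'_def L'_def A'[symmetric] using M R2 by (intro hadamard_pair_digit_sets[OF p A M0 M(2)]) simp
  have cB': "disjoint_differences B B'" "complete_representatives R (sumset B B')"
    unfolding M(1) B'_def A_def using digit_complement[OF p M0 S fin(1) zero(1) cB vB] by simp_all
  have cL': "disjoint_differences L L'" "complete_representatives R (sumset L L')"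
    unfolding M(1) L'_def
    using digit_complement[OF p M0 S' fin(2) zero(2)] cB cards cS' vL by (simp_all add: S'_def)
  have fin': "finite B'" "0 \<in> B'" using hp' by (auto simp: hadamard_pair_iff)
  have "(\<forall>C. extreme_cycle R B' L' C \<longrightarrow> C \<subseteq> \<int>) \<and> Gcd (sumset B B') = 1"
  proof (cases "A = {} \<and> M = 1")
    case True
    have "card B' = 1" "card L' = 1"
      using card_digit_set[OF p A M0] hp' True by (simp_all add: B'_def hadamard_pair_iff)
    then have one: "B' = {0}" "L' = {0}" using hp' by (auto simp: card_1_singleton_iff hadamard_pair_iff)
    have "Gcd B = 1"
      using Gcd_eq_1_of_complete[OF R2 fin] cB'(2) cL'(2) ext by (simp add: one)
    then show ?thesis using cycle_zero R2 by (auto simp: one extreme_cycle_def)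
  next
    case False
    \<comment> \<open>A digit weight: \<open>p ^ i\<close> for a free position \<open>i\<close>, or
      \<open>p ^ \<rho>\<close> when only the leading digit is left.\<close>
    obtain w where w: "w \<in> B'" "w dvd R"
    proof (cases "A = {}")
      case True
      then have "2 \<le> M" using False M0 by linarith
      then have "p ^ \<rho> \<in> B'" unfolding B'_def by (rule top_weight_in_digit_set[OF p A M0])
      then show ?thesis using that M(1) by simp
    next
      case False
      then obtain i where i: "i \<in> A" by blast
      then have "p ^ i \<in> B'" unfolding B'_def by (rule weight_in_digit_set[OF p A M0])
      moreover have "p ^ i dvd R" unfolding M(1) using i A by (intro dvd_mult2 le_imp_power_dvd) auto
      ultimately show ?thesis by (rule that)
    qed
    have "C \<subseteq> \<int>" if "extreme_cycle R B' L' C" for C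
    proof (rule cycle_integral)
      show "cycle R L' C" using that by (simp add: extreme_cycle_def)
      show "real_of_int w * x \<in> \<int>" if "x \<in> C" for x
        using unit_mask_integral[OF fin' w(1)] that \<open>extreme_cycle R B' L' C\<close> by (simp add: extreme_cycle_def)
    qed (use R2 w in auto)
    moreover have "Gcd (sumset B B') = 1"
    proof -
      let ?d = "Gcd (sumset B B')"
      \<comment> \<open>The gcd divides \<open>w\<close>, hence \<open>R\<close>, and also an
        element congruent to 1 modulo \<open>R\<close>.\<close>
      obtain s where s: "s \<in> sumset B B'" "[s = 1] (mod R)"
        using cB'(2) unfolding complete_representatives_def by blast
      have "0 + w \<in> sumset B B'" unfolding sumset_def using zero(1) w(1) by blast
      then have "?d dvd w" using Gcd_dvd by fastforce
      then have "?d dvd R" using w(2) by (rule dvd_trans)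
      moreover have "R dvd s - 1" using s(2) by (simp add: cong_iff_dvd_diff)
      ultimately have "?d dvd s - 1" by (rule dvd_trans)
      from dvd_diff[OF Gcd_dvd[OF s(1)] this] have "is_unit ?d" by simp
      then show ?thesis by (metis is_unit_normalize normalize_Gcd)
    qed
    ultimately show ?thesis by blast
  qed
  then have "complementary R B L B' L'"
    unfolding complementary_def using hp hp' cB' cL' ext by blast
  with hp' show ?thesis by blast
qed

theorem theorem1p22:
  fixes R :: int and B L :: "int set"
  assumes "hadamard_pair R B L"
    and "card B \<in> {2, 3, 4, 5}"
    and "\<And>C. extreme_cycle R B L C \<Longrightarrow> C \<subseteq> \<int>"
  shows "\<exists>B' L'. hadamard_pair R B' L' \<and> complementary R B L B' L'"
proof -
  obtain p S where "digit_structured R p S B L"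
    using assms(2) digit_structured_card_2[OF assms(1)] digit_structured_card_3[OF assms(1)]
      digit_structured_card_4[OF assms(1)] digit_structured_card_5[OF assms(1)] by blast
  then show ?thesis using complementary_of_digit_structured[OF assms(1) _ assms(3)] by blast
qed

end
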